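(* Let $\mathcal{P}$ be a nice pointclass with the property of Baire. If $X$ is a Peano continuum, then there does not exist a strictly increasing infinite sequence $\{G_n\}_{n\in \omega}$ of normal subgroups of $\pi_1(X)$, each of pointclass $\mathcal{P}$, such that $\bigcup_{n\in \omega} G_n = \pi_1(X)$.
   Context: A Peano continuum is a path connected, locally path connected compact metrizable space. For a path connected metric space $X$ and $x\in X$, $L_x$ is the set of loops $[0,1]\to X$ based at $x$ with the sup metric (its topology does not depend on the compatible metric on $X$). For $G\leq \pi_1(X,x)$, $\bigcup G\subseteq L_x$ is the set of all loops whose homotopy class lies in $G$; $G$ is of pointclass $\mathcal{P}$ if $\bigcup G$ belongs to $\mathcal{P}$ in $L_x$ (for a nice pointclass and a normal subgroup this does not depend on the basepoint, so one writes $\pi_1(X)$). A space is Polish if it is completely metrizable and separable; $L_x$ is Polish when $X$ is. A pointclass on Polish spaces assigns to each Polish space a collection of its subsets (of a given topological description). It is nice if it contains the closed sets and is closed under continuous images and preimages (between Polish spaces), countable intersections and finite unions. A subset $Y$ of a space $Z$ has the property of Baire (BP) if there is an open $O\subseteq Z$ with $Y\Delta O$ meager; a pointclass on Polish spaces has BP if each set in it has BP. For example, the class $\Sigma_1^1$ of analytic sets (continuous images of Polish spaces) is nice with BP. *)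

theory Defs
  imports "HOL-Analysis.Analysis" "HOL-Algebra.Coset"
begin

section \<open>Peano continua, loop spaces and fundamental groups\<close>

text \<open>Compact metrizable spaces are rendered as compact subsets of a metric space type; the
  metric is arbitrary, so every compatible metric on the space is covered.\<close>

definition Peano_continuum :: "'a::metric_space set \<Rightarrow> bool"
  where "Peano_continuum X \<longleftrightarrow> compact X \<and> path_connected X \<and> locally path_connected X"

text \<open>Loops are required to be \<open>extensional\<close> on the unit interval, so that they correspond exactly
  to the continuous maps defined on the unit interval only.\<close>

definition loops :: "'a::metric_space set \<Rightarrow> 'a \<Rightarrow> (real \<Rightarrow> 'a) set"
  where "loops X x =
    {p \<in> extensional {0..1}. path p \<and> path_image p \<subseteq> X \<and> pathstart p = x \<and> pathfinish p = x}"

definition loop_metric :: "'a::metric_space set \<Rightarrow> 'a \<Rightarrow> (real \<Rightarrow> 'a) metric"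
  where "loop_metric X x =
    submetric (cfunspace (top_of_set {0..1}) (submetric euclidean_metric X)) (loops X x)"

definition loop_topology :: "'a::metric_space set \<Rightarrow> 'a \<Rightarrow> (real \<Rightarrow> 'a) topology"
  where "loop_topology X x = mtopology_of (loop_metric X x)"

definition loop_homotopy :: "'a::metric_space set \<Rightarrow> 'a \<Rightarrow> ((real \<Rightarrow> 'a) \<times> (real \<Rightarrow> 'a)) set"
  where "loop_homotopy X x = {(p, q). p \<in> loops X x \<and> q \<in> loops X x \<and> homotopic_paths X p q}"

text \<open>Elements are homotopy classes of loops, hence sets of loops: for a set \<open>G\<close> of such classes,
  \<open>\<Union>G\<close> is the set of all loops whose class lies in \<open>G\<close>.  The concatenation \<open>p +++ q\<close> of two loops
  need not be extensional, so the product of two classes is the set of loops homotopic to some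
  concatenation.\<close>

definition fundamental_group :: "'a::metric_space set \<Rightarrow> 'a \<Rightarrow> (real \<Rightarrow> 'a) set monoid"
  where "fundamental_group X x =
    \<lparr>carrier = loops X x // loop_homotopy X x,
     mult = (\<lambda>A B. {r \<in> loops X x. \<exists>p\<in>A. \<exists>q\<in>B. homotopic_paths X (p +++ q) r}),
     one = loop_homotopy X x `` {restrict (\<lambda>_. x) {0..1}}\<rparr>"

section \<open>Polish spaces and pointclasses\<close>

definition Polish_space :: "'a topology \<Rightarrow> bool"
  where "Polish_space Z \<longleftrightarrow> completely_metrizable_space Z \<and> separable_space Z"

definition nowhere_dense_in :: "'a topology \<Rightarrow> 'a set \<Rightarrow> bool"
  where "nowhere_dense_in Z A \<longleftrightarrow> A \<subseteq> topspace Z \<and> Z interior_of (Abstract_Topology.closure_of Z A) = {}"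

definition meager_in :: "'a topology \<Rightarrow> 'a set \<Rightarrow> bool"
  where "meager_in Z A \<longleftrightarrow> (\<exists>F :: nat \<Rightarrow> 'a set. (\<forall>n. nowhere_dense_in Z (F n)) \<and> A = (\<Union>n. F n))"

definition Baire_property_in :: "'a topology \<Rightarrow> 'a set \<Rightarrow> bool"
  where "Baire_property_in Z A \<longleftrightarrow>
    A \<subseteq> topspace Z \<and> (\<exists>U. openin Z U \<and> meager_in Z ((A - U) \<union> (U - A)))"

text \<open>A pointclass assigns a collection of subsets to every Polish space, and HOL cannot quantify
  over the spaces of all types at once.  Every Polish space is homeomorphic to one whose points are
  real sequences (lemma \<open>Polish_space_copy\<close> below), so a pointclass is given by its values on the
  Polish spaces \<open>Z :: (nat \<Rightarrow> real) topology\<close>; here \<open>topspace Z\<close> may be any set of sequences and the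
  topology of \<open>Z\<close> need not be related to the product topology.  The values at topologies that are
  not Polish are irrelevant.\<close>

type_synonym pointclass = "(nat \<Rightarrow> real) topology \<Rightarrow> (nat \<Rightarrow> real) set set"

definition nice_pointclass :: "pointclass \<Rightarrow> bool"
  where "nice_pointclass P \<longleftrightarrow>
    (\<forall>Z. Polish_space Z \<longrightarrow> P Z \<subseteq> Pow (topspace Z)) \<and>
    (\<forall>Z C. Polish_space Z \<and> closedin Z C \<longrightarrow> C \<in> P Z) \<and>
    (\<forall>Y Z f A. Polish_space Y \<and> Polish_space Z \<and> continuous_map Y Z f \<and> A \<in> P Y \<longrightarrow> f ` A \<in> P Z) \<and>
    (\<forall>Y Z f A. Polish_space Y \<and> Polish_space Z \<and> continuous_map Y Z f \<and> A \<in> P Z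
        \<longrightarrow> {y \<in> topspace Y. f y \<in> A} \<in> P Y) \<and>
    (\<forall>Z (A :: nat \<Rightarrow> (nat \<Rightarrow> real) set). Polish_space Z \<and> (\<forall>n. A n \<in> P Z) \<longrightarrow> (\<Inter>n. A n) \<in> P Z) \<and>
    (\<forall>Z A B. Polish_space Z \<and> A \<in> P Z \<and> B \<in> P Z \<longrightarrow> A \<union> B \<in> P Z)"

definition pointclass_BP :: "pointclass \<Rightarrow> bool"
  where "pointclass_BP P \<longleftrightarrow> (\<forall>Z. Polish_space Z \<longrightarrow> (\<forall>A \<in> P Z. Baire_property_in Z A))"

text \<open>Membership in \<open>P\<close> for a subset of a Polish space with points of an arbitrary type is
  membership of the corresponding subset of a homeomorphic copy.  For a nice pointclass the choice
  of the copy and of the homeomorphism does not matter (lemma \<open>of_pointclass_iff\<close> below).\<close>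

definition of_pointclass :: "pointclass \<Rightarrow> 'b topology \<Rightarrow> 'b set \<Rightarrow> bool"
  where "of_pointclass P Z A \<longleftrightarrow>
    A \<subseteq> topspace Z \<and> (\<exists>Z' f. Polish_space Z' \<and> homeomorphic_map Z Z' f \<and> f ` A \<in> P Z')"

definition subgroup_of_pointclass ::
    "pointclass \<Rightarrow> 'a::metric_space set \<Rightarrow> 'a \<Rightarrow> (real \<Rightarrow> 'a) set set \<Rightarrow> bool"
  where "subgroup_of_pointclass P X x G \<longleftrightarrow> of_pointclass P (loop_topology X x) (\<Union>G)"

section \<open>Basic facts\<close>

lemma mspace_loop_metric [simp]: "mspace (loop_metric X x) = loops X x"
proof -
  have "loops X x \<subseteq> mspace (cfunspace (top_of_set {0..1}) (submetric euclidean_metric X))"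
  proof
    fix p assume p: "p \<in> loops X x"
    have top: "mtopology_of (submetric euclidean_metric X) = top_of_set X"
      by (simp add: mtopology_of_submetric)
    have "continuous_map (top_of_set {0..1}) (mtopology_of (submetric euclidean_metric X)) p"
      using p unfolding top by (auto simp: loops_def path_def path_image_def)
    moreover have "compactin (top_of_set {0..1::real}) (topspace (top_of_set {0..1}))"
      by (simp add: compactin_subtopology)
    ultimately show "p \<in> mspace (cfunspace (top_of_set {0..1}) (submetric euclidean_metric X))"
      using p by (subst compactin_mspace_cfunspace) (auto simp: loops_def path_image_def)
  qed
  then show ?thesis
    unfolding loop_metric_def by auto
qed

lemma topspace_loop_topology [simp]: "topspace (loop_topology X x) = loops X x"
  by (simp add: loop_topology_def)

lemma mdist_loop_metric:
  assumes "p \<in> loops X x" "q \<in> loops X x"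
  shows "mdist (loop_metric X x) p q = (SUP t\<in>{0..1}. dist (p t) (q t))"
proof -
  have "p \<in> mspace (cfunspace (top_of_set {0..1}) (submetric euclidean_metric X))"
       "q \<in> mspace (cfunspace (top_of_set {0..1}) (submetric euclidean_metric X))"
    using assms mspace_loop_metric[of X x] unfolding loop_metric_def mspace_submetric by blast+
  then have "p \<in> mspace (funspace {0..1} (submetric euclidean_metric X))"
       "q \<in> mspace (funspace {0..1} (submetric euclidean_metric X))"
    using cfunspace_subset_funspace[of "top_of_set {0..1::real}" "submetric euclidean_metric X"]
    unfolding topspace_euclidean_subtopology by blast+
  then have "p \<in> Metric_space.fspace X dist {0..1}" "q \<in> Metric_space.fspace X dist {0..1}"
    unfolding mspace_funspace mspace_submetric mdist_submetric mspace_euclidean_metric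
      mdist_euclidean_metric Int_UNIV_right by blast+
  then have "Metric_space.fdist X dist {0..1} p q = (SUP t\<in>{0..1}. dist (p t) (q t))"
    unfolding Metric_space.fdist_def[OF Met_TC.subspace[OF subset_UNIV]] by simp
  then show ?thesis
    unfolding loop_metric_def mdist_submetric mdist_cfunspace_eq_mdist_funspace
    by simp
qed

lemma equiv_loop_homotopy: "equiv (loops X x) (loop_homotopy X x)"
  unfolding equiv_def refl_on_def sym_def trans_def loop_homotopy_def
  by (auto simp: loops_def intro: homotopic_paths_sym homotopic_paths_trans)

lemma Polish_space_homeomorphic:
  assumes "Z homeomorphic_space Z'"
  shows "Polish_space Z \<longleftrightarrow> Polish_space Z'"
  using assms homeomorphic_completely_metrizable_space homeomorphic_separable_space
  unfolding Polish_space_def by blast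

lemma Polish_space_copy:
  fixes Z :: "'b topology"
  assumes "Polish_space Z"
  shows "\<exists>(Z' :: (nat \<Rightarrow> real) topology) f. Polish_space Z' \<and> homeomorphic_map Z Z' f"
proof -
  obtain M d where "Metric_space M d" and Z: "Z = Metric_space.mtopology M d"
    using assms unfolding Polish_space_def completely_metrizable_space_def by blast
  then interpret Metric_space M d by simp
  obtain C where C: "countable C" "C \<subseteq> M" "Abstract_Topology.closure_of mtopology C = M"
    using assms unfolding Polish_space_def separable_space_def Z by auto
  define e where "e z = (\<lambda>n. d z (from_nat_into C n))" for z
  have inj: "inj_on e M"
  proof (rule inj_onI, rule ccontr)
    fix y z assume yz: "y \<in> M" "z \<in> M" "e y = e z" "y \<noteq> z"
    define r where "r = d y z / 2"
    have r: "r > 0" using yz by (simp add: r_def)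
    have "y \<in> Abstract_Topology.closure_of mtopology C" using yz C by simp
    then obtain c where c: "c \<in> C" "c \<in> mball y r"
      using r unfolding metric_closure_of by blast
    obtain n where "from_nat_into C n = c"
      using c C(1) by (metis from_nat_into_surj)
    then have "d y c = d z c"
      using fun_cong[OF yz(3), of n] by (simp add: e_def)
    moreover have "d y z \<le> d y c + d z c"
      using triangle[of y c z] yz c C(2) commute by auto
    moreover have "d y c < r" using c by auto
    ultimately show False by (simp add: r_def)
  qed
  define g where "g = inv_into M e"
  have g: "\<And>z. z \<in> M \<Longrightarrow> g (e z) = z"
    using inj by (simp add: g_def)
  define Z' where "Z' = pullback_topology (e ` M) g Z"
  have top: "topspace Z' = e ` M"
    using g by (auto simp: Z'_def topspace_pullback_topology Z)
  have "homeomorphic_maps Z Z' e g"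
    unfolding homeomorphic_maps_def
  proof (intro conjI)
    have "continuous_map Z Z (g \<circ> e)"
      by (rule continuous_map_eq[OF continuous_map_id]) (auto simp: Z g)
    then show "continuous_map Z Z' e"
      unfolding Z'_def by (rule continuous_map_pullback') (auto simp: Z)
    have "continuous_map Z' Z (id \<circ> g)"
      unfolding Z'_def by (rule continuous_map_pullback) auto
    then show "continuous_map Z' Z g" by simp
  qed (auto simp: top Z g)
  then have "homeomorphic_map Z Z' e"
    using homeomorphic_maps_map by blast
  moreover from this have "Polish_space Z'"
    using assms Polish_space_homeomorphic homeomorphic_map_imp_homeomorphic_space by blast
  ultimately show ?thesis by blast
qed

lemma of_pointclass_iff:
  assumes P: "nice_pointclass P" and Z': "Polish_space Z'" and f: "homeomorphic_map Z Z' f"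
    and A: "A \<subseteq> topspace Z"
  shows "of_pointclass P Z A \<longleftrightarrow> f ` A \<in> P Z'"
proof
  assume "of_pointclass P Z A"
  then obtain Y h where Y: "Polish_space Y" "homeomorphic_map Z Y h" "h ` A \<in> P Y"
    unfolding of_pointclass_def by blast
  obtain k where k: "homeomorphic_maps Z Y h k"
    using Y(2) homeomorphic_map_maps by blast
  have "continuous_map Y Z' (f \<circ> k)"
    using k f by (metis continuous_map_compose homeomorphic_imp_continuous_map homeomorphic_maps_def)
  then have "(f \<circ> k) ` (h ` A) \<in> P Z'"
    using P Y Z' unfolding nice_pointclass_def by blast
  moreover have "(f \<circ> k) ` (h ` A) = f ` A"
  proof -
    have "k (h a) = a" if "a \<in> A" for a
      using that A k unfolding homeomorphic_maps_def by blast
    then show ?thesis by (force simp: image_image)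
  qed
  ultimately show "f ` A \<in> P Z'" by simp
qed (use assms in \<open>auto simp: of_pointclass_def\<close>)

lemma homotopic_paths_const_right:
  fixes p :: "real \<Rightarrow> 'a::metric_space"
  assumes "path p" "path_image p \<subseteq> S"
  shows "homotopic_paths S (p +++ (\<lambda>_. pathfinish p)) p"
proof -
  have *: "continuous_on {0..1} (\<lambda>t::real. if t \<le> 1/2 then 2 *\<^sub>R t else 1)"
    unfolding split_01
    by (rule continuous_on_cases continuous_intros | force simp: pathfinish_def joinpaths_def)+
  show ?thesis
    apply (rule homotopic_paths_sym)
    using assms unfolding pathfinish_def joinpaths_def
    by (intro * continuous_on_cases continuous_intros
        homotopic_paths_reparametrize [where f = "\<lambda>t. if t \<le> 1/2 then 2 *\<^sub>R t else 1"]; force)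
qed

lemma homotopic_paths_const_left:
  fixes p :: "real \<Rightarrow> 'a::metric_space"
  assumes "path p" "path_image p \<subseteq> S"
  shows "homotopic_paths S ((\<lambda>_. pathstart p) +++ p) p"
proof -
  have "homotopic_paths S (reversepath (reversepath p +++ (\<lambda>_. pathstart p))) (reversepath (reversepath p))"
    using homotopic_paths_const_right[of "reversepath p" S] assms
    by (intro homotopic_paths_reversepath_D) simp
  moreover have "reversepath (reversepath p +++ (\<lambda>_. pathstart p)) = (\<lambda>_. pathstart p) +++ p"
    by (subst reversepath_joinpaths) (simp_all add: pathstart_def, simp add: reversepath_def)
  ultimately show ?thesis by simp
qed

lemma homotopic_paths_reverse_right:
  fixes p :: "real \<Rightarrow> 'a::metric_space"
  assumes "path p" "path_image p \<subseteq> S"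
  shows "homotopic_paths S (p +++ reversepath p) (\<lambda>_. pathstart p)"
proof -
  have p: "continuous_on {0..1} p"
    using assms by (auto simp: path_def)
  let ?A = "{0..1} \<times> {0..1::real}"
  let ?h = "\<lambda>y. if snd y \<le> 1/2 then p (fst y * (2 * snd y)) else p (fst y * (1 - (2 * snd y - 1)))"
  have h: "continuous_on ?A ?h"
  proof (rule continuous_on_cases_le)
    show "continuous_on {x \<in> ?A. snd x \<le> 1/2} (\<lambda>t. p (fst t * (2 * snd t)))"
         "continuous_on {x \<in> ?A. 1/2 \<le> snd x} (\<lambda>t. p (fst t * (1 - (2 * snd t - 1))))"
         "continuous_on ?A snd"
      by (intro continuous_on_compose2 [OF p] continuous_intros; auto simp: mult_le_one)+
  qed (auto simp: algebra_simps)
  have img: "?h \<in> ?A \<rightarrow> S"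
  proof
    fix y :: "real \<times> real" assume y: "y \<in> ?A"
    have "fst y * (2 * snd y) \<in> {0..1}" if "snd y \<le> 1/2"
      using y that by (auto intro: mult_le_one)
    moreover have "fst y * (1 - (2 * snd y - 1)) \<in> {0..1}" if "\<not> snd y \<le> 1/2"
      using y that by (auto intro: mult_le_one mult_nonneg_nonneg)
    ultimately show "?h y \<in> S"
      using assms(2) unfolding path_image_def by auto
  qed
  have "homotopic_paths S (\<lambda>_. pathstart p) (p +++ reversepath p)"
    unfolding homotopic_paths
    by (intro exI[of _ ?h] conjI h img)
      (auto simp: pathstart_def pathfinish_def joinpaths_def reversepath_def)
  then show ?thesis
    by (rule homotopic_paths_sym)
qed

abbreviation loop_class :: "'a::metric_space set \<Rightarrow> 'a \<Rightarrow> (real \<Rightarrow> 'a) \<Rightarrow> (real \<Rightarrow> 'a) set"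
  where "loop_class X x p \<equiv> {q \<in> loops X x. homotopic_paths X p q}"

lemma restrict_loop:
  assumes "path p" "path_image p \<subseteq> X" "pathstart p = x" "pathfinish p = x"
  shows "restrict p {0..1} \<in> loops X x" "homotopic_paths X p (restrict p {0..1})"
proof -
  show h: "homotopic_paths X p (restrict p {0..1})"
    using assms by (intro homotopic_paths_eq) auto
  show "restrict p {0..1} \<in> loops X x"
    using assms homotopic_paths_imp_path[OF h] homotopic_paths_imp_subset[OF h]
      homotopic_paths_imp_pathstart[OF h] homotopic_paths_imp_pathfinish[OF h]
    by (auto simp: loops_def)
qed

lemma loop_class_eq:
  assumes "homotopic_paths X p q"
  shows "loop_class X x p = loop_class X x q"
  using assms homotopic_paths_sym homotopic_paths_trans by blast

lemma loop_homotopy_Image: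
  assumes "p \<in> loops X x"
  shows "loop_homotopy X x `` {p} = loop_class X x p"
  using assms by (auto simp: loop_homotopy_def)

lemma loop_class_in_carrier:
  assumes "path p" "path_image p \<subseteq> X" "pathstart p = x" "pathfinish p = x"
  shows "loop_class X x p \<in> carrier (fundamental_group X x)"
proof -
  note r = restrict_loop[OF assms]
  have "loop_class X x p = loop_homotopy X x `` {restrict p {0..1}}"
    using loop_class_eq[OF r(2)] loop_homotopy_Image[OF r(1)] by simp
  then show ?thesis
    using r(1) by (simp add: fundamental_group_def quotientI)
qed

lemma carrier_fundamental_groupE:
  assumes "A \<in> carrier (fundamental_group X x)"
  obtains p where "p \<in> loops X x" "A = loop_class X x p"
proof -
  obtain p where "p \<in> loops X x" "A = loop_homotopy X x `` {p}"
    using assms unfolding fundamental_group_def quotient_def by auto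
  then show ?thesis
    using that loop_homotopy_Image by metis
qed

lemma mult_loop_class:
  assumes "p \<in> loops X x" "q \<in> loops X x"
  shows "loop_class X x p \<otimes>\<^bsub>fundamental_group X x\<^esub> loop_class X x q = loop_class X x (p +++ q)"
proof -
  have "homotopic_paths X (p +++ q) (p' +++ q')"
    if "p' \<in> loop_class X x p" "q' \<in> loop_class X x q" for p' q'
    using that assms by (auto simp: loops_def intro: homotopic_paths_join)
  moreover have "p \<in> loop_class X x p" "q \<in> loop_class X x q"
    using assms by (auto simp: loops_def)
  ultimately show ?thesis
    unfolding fundamental_group_def by (simp, blast intro: homotopic_paths_trans)
qed

lemma mult_loop_class':
  assumes "path p" "path_image p \<subseteq> X" "pathstart p = x" "pathfinish p = x"
    and "path q" "path_image q \<subseteq> X" "pathstart q = x" "pathfinish q = x"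
  shows "loop_class X x p \<otimes>\<^bsub>fundamental_group X x\<^esub> loop_class X x q = loop_class X x (p +++ q)"
proof -
  note p = restrict_loop[OF assms(1-4)] and q = restrict_loop[OF assms(5-8)]
  have "homotopic_paths X (p +++ q) (restrict p {0..1} +++ restrict q {0..1})"
    using p q assms by (intro homotopic_paths_join) auto
  then show ?thesis
    unfolding loop_class_eq[OF p(2)] loop_class_eq[OF q(2)] mult_loop_class[OF p(1) q(1)]
    by (rule loop_class_eq[symmetric])
qed

lemma one_fundamental_group:
  assumes "x \<in> X"
  shows "\<one>\<^bsub>fundamental_group X x\<^esub> = loop_class X x (\<lambda>_. x)"
proof -
  have "path (\<lambda>_. x)" "path_image (\<lambda>_. x) \<subseteq> X" "pathstart (\<lambda>_. x) = x" "pathfinish (\<lambda>_. x) = x"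
    using assms by (auto simp: path_def path_image_def pathstart_def pathfinish_def)
  note r = restrict_loop[OF this]
  show ?thesis
    using loop_class_eq[OF r(2)] loop_homotopy_Image[OF r(1)] by (simp add: fundamental_group_def)
qed

lemma group_fundamental_group:
  assumes "x \<in> X"
  shows "group (fundamental_group X x)"
proof -
  let ?G = "fundamental_group X x"
  let ?c = "\<lambda>_::real. x"
  have c: "path ?c" "path_image ?c \<subseteq> X" "pathstart ?c = x" "pathfinish ?c = x"
    using assms by (auto simp: path_def path_image_def pathstart_def pathfinish_def)
  have L: "path p" "path_image p \<subseteq> X" "pathstart p = x" "pathfinish p = x" if "p \<in> loops X x" for p
    using that by (auto simp: loops_def)
  have J: "path (p +++ q)" "path_image (p +++ q) \<subseteq> X" "pathstart (p +++ q) = x" "pathfinish (p +++ q) = x"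
    if "p \<in> loops X x" "q \<in> loops X x" for p q
    using L[OF that(1)] L[OF that(2)] subset_path_image_join[of p X q] by auto
  show ?thesis
  proof (rule groupI)
    fix A B assume "A \<in> carrier ?G" "B \<in> carrier ?G"
    then obtain p q where l: "p \<in> loops X x" "q \<in> loops X x"
      and e: "A = loop_class X x p" "B = loop_class X x q"
      by (elim carrier_fundamental_groupE)
    show "A \<otimes>\<^bsub>?G\<^esub> B \<in> carrier ?G"
      unfolding e mult_loop_class[OF l] by (rule loop_class_in_carrier[OF J[OF l]])
  next
    show "\<one>\<^bsub>?G\<^esub> \<in> carrier ?G"
      using one_fundamental_group[OF assms] loop_class_in_carrier[OF c] by simp
  next
    fix A B C assume "A \<in> carrier ?G" "B \<in> carrier ?G" "C \<in> carrier ?G"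
    then obtain p q r where l: "p \<in> loops X x" "q \<in> loops X x" "r \<in> loops X x"
      and e: "A = loop_class X x p" "B = loop_class X x q" "C = loop_class X x r"
      by (elim carrier_fundamental_groupE)
    have "homotopic_paths X (p +++ (q +++ r)) ((p +++ q) +++ r)"
      using L[OF l(1)] L[OF l(2)] L[OF l(3)] by (intro homotopic_paths_assoc) auto
    then have eq: "loop_class X x (p +++ (q +++ r)) = loop_class X x ((p +++ q) +++ r)"
      by (rule loop_class_eq)
    have "A \<otimes>\<^bsub>?G\<^esub> B \<otimes>\<^bsub>?G\<^esub> C = loop_class X x ((p +++ q) +++ r)"
      unfolding e mult_loop_class[OF l(1,2)] by (rule mult_loop_class'[OF J[OF l(1,2)] L[OF l(3)]])
    moreover have "A \<otimes>\<^bsub>?G\<^esub> (B \<otimes>\<^bsub>?G\<^esub> C) = loop_class X x (p +++ (q +++ r))"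
      unfolding e mult_loop_class[OF l(2,3)] by (rule mult_loop_class'[OF L[OF l(1)] J[OF l(2,3)]])
    ultimately show "A \<otimes>\<^bsub>?G\<^esub> B \<otimes>\<^bsub>?G\<^esub> C = A \<otimes>\<^bsub>?G\<^esub> (B \<otimes>\<^bsub>?G\<^esub> C)"
      using eq by simp
  next
    fix A assume "A \<in> carrier ?G"
    then obtain p where p: "p \<in> loops X x" and e: "A = loop_class X x p"
      by (elim carrier_fundamental_groupE)
    have "homotopic_paths X (?c +++ p) p"
      using homotopic_paths_const_left[of p X] L[OF p] by simp
    then show "\<one>\<^bsub>?G\<^esub> \<otimes>\<^bsub>?G\<^esub> A = A"
      unfolding one_fundamental_group[OF assms] e mult_loop_class'[OF c L[OF p]]
      by (rule loop_class_eq)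
  next
    fix A assume "A \<in> carrier ?G"
    then obtain p where p: "p \<in> loops X x" and e: "A = loop_class X x p"
      by (elim carrier_fundamental_groupE)
    have rp: "path (reversepath p)" "path_image (reversepath p) \<subseteq> X"
        "pathstart (reversepath p) = x" "pathfinish (reversepath p) = x"
      using L[OF p] by auto
    have "homotopic_paths X (reversepath p +++ p) ?c"
      using homotopic_paths_reverse_right[OF rp(1,2)] rp L[OF p] by simp
    then have "loop_class X x (reversepath p +++ p) = loop_class X x ?c"
      by (rule loop_class_eq)
    then have "loop_class X x (reversepath p) \<otimes>\<^bsub>?G\<^esub> A = \<one>\<^bsub>?G\<^esub>"
      unfolding one_fundamental_group[OF assms] e mult_loop_class'[OF rp L[OF p]] .
    then show "\<exists>B\<in>carrier ?G. B \<otimes>\<^bsub>?G\<^esub> A = \<one>\<^bsub>?G\<^esub>"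
      using loop_class_in_carrier[OF rp] by blast
  qed
qed

end

theory Submission
  imports Defs
begin

text \<open>Suppose that some point \<open>y\<close> has, for every \<open>n\<close>, arbitrarily small loops not in \<open>G n\<close>; pick
  such loops \<open>l n\<close> shrinking to \<open>y\<close>.  A point \<open>\<alpha>\<close> of the Cantor space gives the infinite
  concatenation of those \<open>l n\<close> with \<open>\<alpha> n = 1\<close>, and this depends continuously on \<open>\<alpha>\<close>, so by the Baire
  property some \<open>G n\<close> is comeager on a basic open set.  There it contains two concatenations that differ
  only in the factor \<open>l m\<close> for some \<open>m \<ge> n\<close>, and normality puts \<open>l m\<close> into \<open>G n\<close>, a contradiction.
  By compactness all loops of diameter below some \<open>\<epsilon>\<close> then lie in one \<open>G N\<close>.  Modulo such loops the
  fundamental group is generated by finitely many elements, one for each pair of intersecting sets of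
  a finite cover by small path connected sets; as soon as \<open>G M\<close> contains them, it is everything.\<close>

section \<open>Path classes as a cocycle in the fundamental group\<close>

definition path_between :: "'a::metric_space set \<Rightarrow> 'a \<Rightarrow> 'a \<Rightarrow> (real \<Rightarrow> 'a) \<Rightarrow> bool"
  where "path_between X a b p \<longleftrightarrow>
    path p \<and> path_image p \<subseteq> X \<and> pathstart p = a \<and> pathfinish p = b"

lemma path_between_join:
  "path_between X a b p \<Longrightarrow> path_between X b c q \<Longrightarrow> path_between X a c (p +++ q)"
  using subset_path_image_join[of p X q] by (auto simp: path_between_def)

lemma path_between_reverse: "path_between X a b p \<Longrightarrow> path_between X b a (reversepath p)"
  by (auto simp: path_between_def)

lemma path_between_const: "a \<in> X \<Longrightarrow> path_between X a a (\<lambda>_. a)"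
  by (auto simp: path_between_def path_def path_image_def pathstart_def pathfinish_def)

lemma path_between_mono: "path_between X a b p \<Longrightarrow> X \<subseteq> Y \<Longrightarrow> path_between Y a b p"
  by (auto simp: path_between_def)

lemma path_between_endpoints:
  assumes "path_between X a b p"
  shows "a \<in> X" "b \<in> X"
  using assms pathstart_in_path_image[of p] pathfinish_in_path_image[of p]
  by (auto simp: path_between_def)

lemma path_between_exists:
  "path_connected X \<Longrightarrow> a \<in> X \<Longrightarrow> b \<in> X \<Longrightarrow> \<exists>p. path_between X a b p"
  unfolding path_connected_def path_between_def by blast

text \<open>After reassociation the detour \<open>reversepath s +++ s\<close> to the base point
  stands in the middle and is null-homotopic. This cancellation is what makes
  \<open>path_class\<close> multiplicative.\<close>

lemma homotopic_loop_insertion: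
  assumes p: "path_between X a b p" and s: "path_between X x b s" and q: "path_between X b c q"
    and r: "path_between X x a r" and t: "path_between X x c t"
  shows "homotopic_paths X ((r +++ (p +++ reversepath s)) +++ (s +++ (q +++ reversepath t)))
           (r +++ ((p +++ q) +++ reversepath t))"
proof -
  let ?s = "reversepath s" and ?t = "reversepath t"
  note J = path_between_join
  have s': "path_between X b x ?s" and t': "path_between X c x ?t"
    using s t by (auto intro: path_between_reverse)
  have refl: "homotopic_paths X u u" if "path_between X d e u" for d e u
    using that by (simp add: path_between_def)
  have assoc: "homotopic_paths X ((u +++ v) +++ w) (u +++ (v +++ w))"
    if "path_between X d e u" "path_between X e f v" "path_between X f g w" for d e f g u v w
    using that by (intro homotopic_paths_sym[OF homotopic_paths_assoc]) (auto simp: path_between_def)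
  have cong: "homotopic_paths X (u +++ v) (u +++ v')"
    if "homotopic_paths X v v'" "path_between X d e u" "path_between X e f v" for d e f u v v'
    using that refl by (intro homotopic_paths_join) (auto simp: path_between_def)
  have cong_left: "homotopic_paths X (u +++ v) (u' +++ v)"
    if "homotopic_paths X u u'" "path_between X d e u" "path_between X e f v" for d e f u u' v
    using that refl by (intro homotopic_paths_join) (auto simp: path_between_def)
  have qt: "path_between X b x (q +++ ?t)"
    using J[OF q t'] .
  have "homotopic_paths X (?s +++ s) (\<lambda>_. b)"
    using homotopic_paths_reverse_right[of ?s X] s' by (simp add: path_between_def)
  then have "homotopic_paths X ((?s +++ s) +++ (q +++ ?t)) ((\<lambda>_. b) +++ (q +++ ?t))"
    by (rule cong_left[OF _ J[OF s' s] qt])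
  also have "homotopic_paths X ((\<lambda>_. b) +++ (q +++ ?t)) (q +++ ?t)"
    using homotopic_paths_const_left[of "q +++ ?t" X] qt by (simp add: path_between_def)
  finally (homotopic_paths_trans) have 1: "homotopic_paths X ((?s +++ s) +++ (q +++ ?t)) (q +++ ?t)" .
  have 2: "homotopic_paths X (?s +++ (s +++ (q +++ ?t))) (q +++ ?t)"
    using homotopic_paths_trans[OF homotopic_paths_sym[OF assoc[OF s' s qt]] 1] .
  have "homotopic_paths X ((p +++ ?s) +++ (s +++ (q +++ ?t))) (p +++ (?s +++ (s +++ (q +++ ?t))))"
    by (rule assoc[OF p s' J[OF s qt]])
  also have "homotopic_paths X (p +++ (?s +++ (s +++ (q +++ ?t)))) (p +++ (q +++ ?t))"
    by (rule cong[OF 2 p J[OF s' J[OF s qt]]])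
  also (homotopic_paths_trans) have "homotopic_paths X (p +++ (q +++ ?t)) ((p +++ q) +++ ?t)"
    by (rule homotopic_paths_sym[OF assoc[OF p q t']])
  finally (homotopic_paths_trans)
  have 3: "homotopic_paths X ((p +++ ?s) +++ (s +++ (q +++ ?t))) ((p +++ q) +++ ?t)" .
  show ?thesis
    by (rule homotopic_paths_trans[OF assoc[OF r J[OF p s'] J[OF s qt]]
        cong[OF 3 r J[OF J[OF p s'] J[OF s qt]]]])
qed

text \<open>The case \<open>a = x\<close> is pinned to the constant path so that
  \<open>path_class\<close> agrees with the ordinary homotopy class on loops at the base point; at
  other points any choice will do.\<close>

definition connecting_path :: "'a::metric_space set \<Rightarrow> 'a \<Rightarrow> 'a \<Rightarrow> real \<Rightarrow> 'a"
  where "connecting_path X x a = (if a = x then (\<lambda>_. x) else SOME p. path_between X x a p)"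

text \<open>Closing up every path by fixed connecting paths to the base point turns concatenation of
  arbitrary paths into multiplication in the fundamental group.\<close>

definition path_class :: "'a::metric_space set \<Rightarrow> 'a \<Rightarrow> (real \<Rightarrow> 'a) \<Rightarrow> (real \<Rightarrow> 'a) set"
  where "path_class X x p = loop_class X x
    (connecting_path X x (pathstart p) +++ (p +++ reversepath (connecting_path X x (pathfinish p))))"

locale path_connected_space =
  fixes X :: "'a::metric_space set" and x :: 'a
  assumes path_connected: "path_connected X" and basepoint: "x \<in> X"
begin

sublocale group "fundamental_group X x"
  by (rule group_fundamental_group[OF basepoint])

lemma connecting_path: "a \<in> X \<Longrightarrow> path_between X x a (connecting_path X x a)"
  using someI_ex[OF path_between_exists[OF path_connected basepoint]] path_between_const[OF basepoint]
  by (auto simp: connecting_path_def)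

lemma closed_up_path:
  assumes "path_between X a b p"
  shows "path_between X x x
    (connecting_path X x a +++ (p +++ reversepath (connecting_path X x b)))"
  using path_between_endpoints[OF assms] assms
  by (blast intro: path_between_join path_between_reverse connecting_path)

lemma path_class_closed:
  assumes "path_between X a b p"
  shows "path_class X x p \<in> carrier (fundamental_group X x)"
  using closed_up_path[OF assms] assms loop_class_in_carrier
  by (fastforce simp: path_class_def path_between_def)

lemma path_class_join:
  assumes p: "path_between X a b p" and q: "path_between X b c q"
  shows "path_class X x (p +++ q) = path_class X x p \<otimes>\<^bsub>fundamental_group X x\<^esub> path_class X x q"
proof -
  let ?c = "connecting_path X x"
  have e: "pathstart p = a" "pathfinish p = b" "pathstart q = b" "pathfinish q = c"
    using p q by (auto simp: path_between_def)
  have "path_class X x p \<otimes>\<^bsub>fundamental_group X x\<^esub> path_class X x q =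
      loop_class X x ((?c a +++ (p +++ reversepath (?c b))) +++ (?c b +++ (q +++ reversepath (?c c))))"
    using closed_up_path[OF p] closed_up_path[OF q] unfolding path_class_def e path_between_def
    by (intro mult_loop_class') auto
  also have "\<dots> = loop_class X x (?c a +++ ((p +++ q) +++ reversepath (?c c)))"
    using path_between_endpoints[OF p] path_between_endpoints[OF q]
    by (intro loop_class_eq homotopic_loop_insertion[OF p _ q, where x = x] connecting_path)
  finally show ?thesis
    unfolding path_class_def by (simp add: e)
qed

lemma path_class_cong:
  assumes p: "path_between X a b p" and h: "homotopic_paths X p q"
  shows "path_class X x p = path_class X x q"
proof -
  have e: "pathstart q = pathstart p" "pathfinish q = pathfinish p"
    using h homotopic_paths_imp_pathstart homotopic_paths_imp_pathfinish by metis+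
  note c = connecting_path[OF path_between_endpoints(1)[OF p]]
    connecting_path[OF path_between_endpoints(2)[OF p]]
  show ?thesis
    unfolding path_class_def e using c p
    by (intro loop_class_eq homotopic_paths_join h) (auto simp: path_between_def)
qed

lemma path_class_cong_on:
  assumes p: "path_between X a b p" and eq: "\<And>t. t \<in> {0..1} \<Longrightarrow> p t = q t"
  shows "path_class X x p = path_class X x q"
  using assms by (intro path_class_cong[OF p] homotopic_paths_eq) (auto simp: path_between_def)

lemma path_class_const:
  assumes "a \<in> X"
  shows "path_class X x (\<lambda>_. a) = \<one>\<^bsub>fundamental_group X x\<^esub>"
proof -
  have c: "path_between X a a (\<lambda>_. a)"
    using path_between_const[OF assms] .
  \<comment> \<open>The class of a constant path is idempotent, and the only idempotent of a group
    is its identity.\<close>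
  have "(\<lambda>_. a) +++ (\<lambda>_. a) = (\<lambda>_. a)"
    by (simp add: joinpaths_def fun_eq_iff)
  then show ?thesis
    using path_class_join[OF c c] path_class_closed[OF c] l_cancel_one' by auto
qed

lemma path_class_reverse:
  assumes p: "path_between X a b p"
  shows "path_class X x (reversepath p) = inv\<^bsub>fundamental_group X x\<^esub> path_class X x p"
proof -
  note p' = path_between_reverse[OF p]
  have "homotopic_paths X (reversepath p +++ p) (\<lambda>_. b)"
    using homotopic_paths_reverse_right[of "reversepath p" X] p' by (simp add: path_between_def)
  then have "path_class X x (reversepath p) \<otimes>\<^bsub>fundamental_group X x\<^esub> path_class X x p = \<one>\<^bsub>fundamental_group X x\<^esub>"
    using path_class_cong[OF path_between_join[OF p' p]] path_class_join[OF p' p]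
      path_class_const[OF path_between_endpoints(2)[OF p]] by simp
  then show ?thesis
    using inv_equality path_class_closed[OF p] path_class_closed[OF p'] by metis
qed

lemma path_class_loop:
  assumes p: "path_between X x x p"
  shows "path_class X x p = loop_class X x p"
proof -
  let ?c = "\<lambda>_::real. x"
  have e: "pathstart p = x" "pathfinish p = x" "reversepath ?c = ?c"
    using p by (auto simp: path_between_def reversepath_def)
  have pc: "path_between X x x (p +++ ?c)"
    by (rule path_between_join[OF p path_between_const[OF basepoint]])
  have "homotopic_paths X (?c +++ (p +++ ?c)) (p +++ ?c)"
    using homotopic_paths_const_left[of "p +++ ?c" X] pc by (auto simp: path_between_def)
  also have "homotopic_paths X (p +++ ?c) p"
    using homotopic_paths_const_right[of p X] p by (auto simp: path_between_def)
  finally (homotopic_paths_trans) have "homotopic_paths X (?c +++ (p +++ ?c)) p" .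
  then show ?thesis
    unfolding path_class_def e connecting_path_def if_P[OF refl] by (rule loop_class_eq)
qed

text \<open>\<open>c\<close> need not be a loop, but its \<open>path_class\<close> is still a group
  element, so a loop and its transport along \<open>c\<close> have conjugate classes. Hence
  membership in a normal subgroup makes sense for loops based anywhere in \<open>X\<close>.\<close>

lemma path_class_conjugate:
  assumes N: "N \<lhd> fundamental_group X x"
    and c: "path_between X a b c" and l: "path_between X b b l"
  shows "path_class X x (c +++ (l +++ reversepath c)) \<in> N \<longleftrightarrow> path_class X x l \<in> N"
proof -
  interpret N: normal N "fundamental_group X x" by (rule N)
  note r = path_between_reverse[OF c]
  note C = path_class_closed[OF c] and L = path_class_closed[OF l]
  have eq: "path_class X x (c +++ (l +++ reversepath c)) = path_class X x c
      \<otimes>\<^bsub>fundamental_group X x\<^esub> path_class X x l \<otimes>\<^bsub>fundamental_group X x\<^esub> inv\<^bsub>fundamental_group X x\<^esub> path_class X x c"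
    using path_class_join[OF c path_between_join[OF l r]] path_class_join[OF l r]
      path_class_reverse[OF c] C L by (simp add: m_assoc)
  show ?thesis
  proof
    assume "path_class X x l \<in> N"
    then show "path_class X x (c +++ (l +++ reversepath c)) \<in> N"
      unfolding eq by (rule N.inv_op_closed2[OF C])
  next
    assume "path_class X x (c +++ (l +++ reversepath c)) \<in> N"
    from N.inv_op_closed1[OF C this] show "path_class X x l \<in> N"
      unfolding eq using C L by (simp add: m_assoc flip: m_assoc[of "inv\<^bsub>fundamental_group X x\<^esub> _"])
  qed
qed

text \<open>Homotopy classes are pairwise disjoint, so \<open>p\<close> can lie in no member of
  \<open>G\<close> other than its own class. This links the topological hypothesis on
  \<open>\<Union>G\<close> to the algebra of \<open>G\<close>.\<close>

lemma mem_Union_classes_iff: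
  assumes G: "G \<subseteq> carrier (fundamental_group X x)" and p: "p \<in> loops X x"
  shows "p \<in> \<Union>G \<longleftrightarrow> loop_class X x p \<in> G"
proof
  assume "p \<in> \<Union>G"
  then obtain A where A: "p \<in> A" "A \<in> G" by blast
  then obtain q where "q \<in> loops X x" "A = loop_class X x q"
    using G carrier_fundamental_groupE by blast
  then show "loop_class X x p \<in> G"
    using A loop_class_eq[of X q p x] by auto
next
  assume "loop_class X x p \<in> G"
  moreover have "p \<in> loop_class X x p"
    using p by (auto simp: loops_def)
  ultimately show "p \<in> \<Union>G" by blast
qed

end

section \<open>Finite generation modulo small loops\<close>

text \<open>The library's \<open>subpath\<close> is restricted to normed spaces.\<close>

definition path_piece :: "real \<Rightarrow> real \<Rightarrow> (real \<Rightarrow> 'a) \<Rightarrow> real \<Rightarrow> 'a"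
  where "path_piece u v p = p \<circ> subpath u v id"

text \<open>The homotopy is found in the parameter interval, between subpaths of the identity, and
  then pushed forward along \<open>p\<close>.\<close>

lemma homotopic_paths_join_path_pieces:
  fixes p :: "real \<Rightarrow> 'a::metric_space"
  assumes p: "path p" "path_image p \<subseteq> X" and u: "u \<in> {0..1}" "v \<in> {0..1}" "w \<in> {0..1}"
  shows "homotopic_paths X (path_piece u v p +++ path_piece v w p) (path_piece u w p)"
proof -
  have "homotopic_paths {0..1} (subpath u v id +++ subpath v w id) (subpath u w (id :: real \<Rightarrow> real))"
    using u by (intro homotopic_join_subpaths) (auto simp: path_def path_image_def)
  then have "homotopic_paths X (p \<circ> (subpath u v id +++ subpath v w id)) (p \<circ> subpath u w id)"
    using p by (intro homotopic_paths_continuous_image) (auto simp: path_def path_image_def)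
  then show ?thesis
    by (simp add: path_piece_def path_compose_join)
qed

lemma path_between_path_piece:
  fixes p :: "real \<Rightarrow> 'a::metric_space"
  assumes p: "path p" and uv: "0 \<le> u" "u \<le> v" "v \<le> 1" and im: "p ` {u..v} \<subseteq> X"
  shows "path_between X (p u) (p v) (path_piece u v p)"
proof -
  have im': "path_image (subpath u v id) = {u..v}"
    using uv by (simp add: path_image_subpath)
  have "path (subpath u v (id :: real \<Rightarrow> real))"
    using uv by (intro path_subpath) (auto simp: path_def)
  moreover have "continuous_on {u..v} p"
    using p uv by (auto simp: path_def intro: continuous_on_subset)
  ultimately have "path (path_piece u v p)"
    unfolding path_piece_def using im' by (intro path_continuous_image) simp_all
  then show ?thesis
    using im im' by (simp add: path_between_def path_piece_def path_image_compose
        pathstart_compose pathfinish_compose)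
qed

text \<open>A relatively open path connected set is written as the trace on \<open>X\<close> of an
  open set \<open>V\<close> of the whole space, the form that the covering arguments for compact
  \<open>X\<close> ask for.\<close>

lemma locally_path_connected_neighbourhood:
  fixes X :: "'a::metric_space set"
  assumes "locally path_connected X" "y \<in> X" "\<epsilon> > 0"
  shows "\<exists>V. open V \<and> y \<in> V \<and> path_connected (X \<inter> V) \<and> X \<inter> V \<subseteq> ball y \<epsilon>"
proof -
  have "openin (top_of_set X) (X \<inter> ball y \<epsilon>)" "y \<in> X \<inter> ball y \<epsilon>"
    using assms by (auto simp: openin_open_Int)
  then obtain U where U: "openin (top_of_set X) U" "path_connected U" "y \<in> U" "U \<subseteq> X \<inter> ball y \<epsilon>"
    using assms(1) unfolding locally_path_connected by meson
  then obtain V where "open V" "U = X \<inter> V"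
    by (auto simp: openin_open)
  then show ?thesis
    using U by auto
qed

definition contains_small_loops :: "'a::metric_space set \<Rightarrow> 'a \<Rightarrow> real \<Rightarrow> (real \<Rightarrow> 'a) set set \<Rightarrow> bool"
  where "contains_small_loops X x \<epsilon> H \<longleftrightarrow>
    (\<forall>z\<in>X. \<forall>a l. path_between (X \<inter> ball z \<epsilon>) a a l \<longrightarrow> path_class X x l \<in> H)"

context path_connected_space
begin

text \<open>Local path connectedness spreads the condition at \<open>y\<close> to loops based
  anywhere in a neighbourhood of \<open>y\<close>. Finitely many such neighbourhoods cover
  \<open>X\<close>, and since \<open>G\<close> is increasing the largest of their indices serves all
  of them.\<close>

lemma uniformly_small_loops:
  assumes X: "compact X" "locally path_connected X"
    and G: "mono G" "\<And>n::nat. G n \<lhd> fundamental_group X x"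
    and local: "\<And>y. y \<in> X \<Longrightarrow>
      \<exists>n. \<exists>\<epsilon>>0. \<forall>l. path_between (X \<inter> ball y \<epsilon>) y y l \<longrightarrow> path_class X x l \<in> G n"
  obtains N \<epsilon> where "\<epsilon> > 0" "contains_small_loops X x \<epsilon> (G N)"
proof -
  have "\<exists>n V. open V \<and> y \<in> V \<and> (\<forall>a l. path_between (X \<inter> V) a a l \<longrightarrow> path_class X x l \<in> G n)"
    if y: "y \<in> X" for y
  proof -
    obtain n \<epsilon> where \<epsilon>: "\<epsilon> > 0"
      "\<And>l. path_between (X \<inter> ball y \<epsilon>) y y l \<Longrightarrow> path_class X x l \<in> G n"
      using local[OF y] by blast
    obtain V where V: "open V" "y \<in> V" "path_connected (X \<inter> V)" "X \<inter> V \<subseteq> ball y \<epsilon>"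
      using locally_path_connected_neighbourhood[OF X(2) y \<epsilon>(1)] by blast
    have "path_class X x l \<in> G n" if l: "path_between (X \<inter> V) a a l" for a l
    proof -
      obtain c where c: "path_between (X \<inter> V) y a c"
        using path_between_exists[OF V(3)] path_between_endpoints[OF l] y V(2) by blast
      \<comment> \<open>Conjugating by \<open>c\<close> moves the base point to \<open>y\<close>
        without leaving the ball; normality then brings the membership back to
        \<open>l\<close>.\<close>
      have "path_between (X \<inter> ball y \<epsilon>) y y (c +++ (l +++ reversepath c))"
        using V(4) by (intro path_between_mono[OF path_between_join[OF c path_between_join[OF l path_between_reverse[OF c]]]]) auto
      then show ?thesis
        using \<epsilon>(2) path_class_conjugate[OF G(2)] path_between_mono[OF c] path_between_mono[OF l]
        by (meson inf_le1)
    qed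
    then show ?thesis using V by blast
  qed
  then obtain n V where V: "\<And>y. y \<in> X \<Longrightarrow> open (V y)" "\<And>y. y \<in> X \<Longrightarrow> y \<in> V y"
    "\<And>y a l. y \<in> X \<Longrightarrow> path_between (X \<inter> V y) a a l \<Longrightarrow> path_class X x l \<in> G (n y)"
    by metis
  obtain F where F: "F \<subseteq> X" "finite F" "X \<subseteq> (\<Union>y\<in>F. V y)"
    using compactE_image[OF X(1), of X V] V(1,2) by blast
  \<comment> \<open>\<open>\<epsilon>\<close> is a Lebesgue number of the finite cover.\<close>
  obtain \<epsilon> where \<epsilon>: "\<epsilon> > 0" "\<And>z. z \<in> X \<Longrightarrow> \<exists>B\<in>V ` F. ball z \<epsilon> \<subseteq> B"
    using Heine_Borel_lemma[OF X(1), of "V ` F"] F V(1) by blast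
  have "contains_small_loops X x \<epsilon> (G (Max (n ` F)))"
    unfolding contains_small_loops_def
  proof (intro ballI allI impI)
    fix z a l assume "z \<in> X" and l: "path_between (X \<inter> ball z \<epsilon>) a a l"
    then obtain y where y: "y \<in> F" "ball z \<epsilon> \<subseteq> V y"
      using \<epsilon>(2) by blast
    have "path_class X x l \<in> G (n y)"
      using y F(1) by (intro V(3)[OF _ path_between_mono[OF l]]) auto
    moreover have "G (n y) \<subseteq> G (Max (n ` F))"
      using F(2) y(1) by (intro monoD[OF G(1)]) auto
    ultimately show "path_class X x l \<in> G (Max (n ` F))" by blast
  qed
  then show ?thesis
    by (rule that[OF \<epsilon>(1)])
qed

text \<open>Cut a loop into pieces lying in single cover sets and join the cut points to the centres
  of these sets: modulo small loops, each passage from one centre to the next becomes a generator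
  from \<open>E\<close>. Since \<open>E\<close> does not depend on \<open>H\<close>, the final
  argument can fix \<open>E\<close> first and then take \<open>H\<close> large enough to contain
  it.\<close>

lemma finitely_generated_modulo_small_loops:
  assumes X: "compact X" "locally path_connected X" and "\<epsilon> > 0"
  obtains E where "finite E" "E \<subseteq> carrier (fundamental_group X x)"
    "\<And>H. H \<lhd> fundamental_group X x \<Longrightarrow> E \<subseteq> H \<Longrightarrow>
      contains_small_loops X x \<epsilon> H \<Longrightarrow> H = carrier (fundamental_group X x)"
proof -
  let ?\<pi> = "fundamental_group X x" and ?\<Phi> = "path_class X x"
  \<comment> \<open>Two intersecting sets of radius \<open>\<epsilon> / 3\<close> lie together in
    the ball of radius \<open>\<epsilon>\<close> about either centre, so loops in their union are
    small.\<close>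
  have "\<exists>V. open V \<and> y \<in> V \<and> path_connected (X \<inter> V) \<and> X \<inter> V \<subseteq> ball y (\<epsilon> / 3)" if "y \<in> X" for y
    using locally_path_connected_neighbourhood[OF X(2) that, of "\<epsilon> / 3"] \<open>\<epsilon> > 0\<close> by simp
  then obtain V where V: "\<And>y. y \<in> X \<Longrightarrow> open (V y)" "\<And>y. y \<in> X \<Longrightarrow> y \<in> V y"
    "\<And>y. y \<in> X \<Longrightarrow> path_connected (X \<inter> V y)" "\<And>y. y \<in> X \<Longrightarrow> X \<inter> V y \<subseteq> ball y (\<epsilon> / 3)"
    by metis
  obtain F where F: "F \<subseteq> X" "finite F" "X \<subseteq> (\<Union>y\<in>F. V y)"
    using compactE_image[OF X(1), of X V] V(1,2) by blast
  define W where "W y = X \<inter> V y" for y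
  define D where "D = {(y, z). y \<in> F \<and> z \<in> F \<and> W y \<inter> W z \<noteq> {}}"
  have "\<exists>e. path_between (W y \<union> W z) y z e" if yz: "(y, z) \<in> D" for y z
  proof -
    obtain u where u: "u \<in> W y" "u \<in> W z" and X: "y \<in> X" "z \<in> X"
      using yz F(1) unfolding D_def by blast
    obtain c d where c: "path_between (W y) y u c" and d: "path_between (W z) u z d"
      using path_between_exists[of "W y" y u] path_between_exists[of "W z" u z] V(2,3) X u
      unfolding W_def by blast
    then show ?thesis
      using path_between_join[OF path_between_mono[OF c Un_upper1] path_between_mono[OF d Un_upper2]] by blast
  qed
  then obtain e where e: "\<And>y z. (y, z) \<in> D \<Longrightarrow> path_between (W y \<union> W z) y z (e y z)"
    by metis
  have WX: "W y \<subseteq> X" "W y \<union> W z \<subseteq> X" for y z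
    by (auto simp: W_def)
  \<comment> \<open>In both collections item 1 treats paths inside one cover set, item 2 paths
    inside the union of two.\<close>
  note to_X = path_between_mono[OF _ WX(1)] path_between_mono[OF _ WX(2)]
  note \<Phi>_closed = path_class_closed[OF to_X(1)] path_class_closed[OF to_X(2)]
  define E where "E = (\<lambda>(y, z). ?\<Phi> (e y z)) ` D"
  show ?thesis
  proof (rule that[of E])
    have "D \<subseteq> F \<times> F" by (auto simp: D_def)
    then show "finite E"
      unfolding E_def using F(2) by (meson finite_SigmaI finite_imageI finite_subset)
    show "E \<subseteq> carrier ?\<pi>"
      unfolding E_def using \<Phi>_closed(2)[OF e] by auto
  next
    fix H
    assume H: "H \<lhd> ?\<pi>" "E \<subseteq> H"
      and small: "contains_small_loops X x \<epsilon> H"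
    interpret H: normal H ?\<pi> by (rule H(1))
    \<comment> \<open>The coset of \<open>?\<Phi> c\<close> modulo \<open>H\<close> depends only on the end point \<open>u\<close>, not on the member of the
      cover in which \<open>c\<close> runs.\<close>
    have coset_eq: "?\<Phi> c \<otimes>\<^bsub>?\<pi>\<^esub> inv\<^bsub>?\<pi>\<^esub> ?\<Phi> d \<in> H"
      if yz: "y \<in> F" "z \<in> F" and c: "path_between (W y) y u c" and d: "path_between (W z) z u d"
      for y z u c d
    proof -
      have "u \<in> W y" "u \<in> W z"
        using path_between_endpoints[OF c] path_between_endpoints[OF d] by auto
      then have D: "(y, z) \<in> D"
        using yz by (auto simp: D_def)
      have "dist y a < \<epsilon>" if "a \<in> W y \<union> W z" for a
      proof -
        have b: "dist y b < \<epsilon> / 3" if "b \<in> W y" "y \<in> F" for b y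
          using V(4)[of y] that F(1) unfolding W_def mem_ball[symmetric] by blast
        have "dist y a < \<epsilon> / 3 \<or> dist y u < \<epsilon> / 3 \<and> dist z u < \<epsilon> / 3 \<and> dist z a < \<epsilon> / 3"
          using that b yz \<open>u \<in> W y\<close> \<open>u \<in> W z\<close> by blast
        then show ?thesis
          using dist_triangle[of y a u] dist_triangle[of u a z] \<open>\<epsilon> > 0\<close> by (auto simp: dist_commute)
      qed
      then have ball: "W y \<union> W z \<subseteq> X \<inter> ball y \<epsilon>"
        by (auto simp: W_def)
      note c' = path_between_mono[OF c, of "W y \<union> W z"]
        and d' = path_between_reverse[OF path_between_mono[OF d, of "W y \<union> W z"]]
        and e' = path_between_reverse[OF e[OF D]]
      note de = path_between_join[OF d' e']
      \<comment> \<open>This loop runs from \<open>y\<close> to \<open>u\<close> along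
        \<open>c\<close>, on to \<open>z\<close> against \<open>d\<close>, and back to
        \<open>y\<close> against \<open>e y z\<close>. It stays in the ball, so its class is in
        \<open>H\<close>, and the factor from \<open>e y z\<close> can be cancelled because that
        class lies in \<open>E\<close>.\<close>
      have "path_between (W y \<union> W z) y y (c +++ (reversepath d +++ reversepath (e y z)))"
        by (rule path_between_join[OF c' de]) auto
      then have "?\<Phi> (c +++ (reversepath d +++ reversepath (e y z))) \<in> H"
        using small yz F(1) path_between_mono[OF _ ball] unfolding contains_small_loops_def by blast
      also have "?\<Phi> (c +++ (reversepath d +++ reversepath (e y z))) =
          ?\<Phi> c \<otimes>\<^bsub>?\<pi>\<^esub> (inv\<^bsub>?\<pi>\<^esub> ?\<Phi> d \<otimes>\<^bsub>?\<pi>\<^esub> inv\<^bsub>?\<pi>\<^esub> ?\<Phi> (e y z))"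
        using path_class_join[OF to_X(2)[OF c'] to_X(2)[OF de]]
          path_class_join[OF to_X(2)[OF d'] to_X(2)[OF e']]
          path_class_reverse[OF to_X(1)[OF d]] path_class_reverse[OF to_X(2)[OF e[OF D]]]
        by simp
      finally have "?\<Phi> c \<otimes>\<^bsub>?\<pi>\<^esub> (inv\<^bsub>?\<pi>\<^esub> ?\<Phi> d \<otimes>\<^bsub>?\<pi>\<^esub> inv\<^bsub>?\<pi>\<^esub> ?\<Phi> (e y z)) \<in> H" .
      moreover have "?\<Phi> (e y z) \<in> H"
        using H(2) D by (auto simp: E_def)
      ultimately have "?\<Phi> c \<otimes>\<^bsub>?\<pi>\<^esub> (inv\<^bsub>?\<pi>\<^esub> ?\<Phi> d \<otimes>\<^bsub>?\<pi>\<^esub> inv\<^bsub>?\<pi>\<^esub> ?\<Phi> (e y z)) \<otimes>\<^bsub>?\<pi>\<^esub> ?\<Phi> (e y z) \<in> H"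
        by (rule H.m_closed)
      then show ?thesis
        using \<Phi>_closed(1)[OF c] \<Phi>_closed(1)[OF d] \<Phi>_closed(2)[OF e[OF D]] by (simp add: m_assoc)
    qed
    have path_in_H: "?\<Phi> c \<otimes>\<^bsub>?\<pi>\<^esub> ?\<Phi> p \<otimes>\<^bsub>?\<pi>\<^esub> inv\<^bsub>?\<pi>\<^esub> ?\<Phi> d \<in> H"
      if p: "path_between X (p 0) (p 1) p" and yz: "y \<in> F" "z \<in> F"
        and c: "path_between (W y) y (p 0) c" and d: "path_between (W z) z (p 1) d"
      for p y z c d
    proof -
      \<comment> \<open>Quantifying over all cover sets and connecting paths at both ends lets
        adjacent intervals share one choice at their common end point.\<close>
      define Q where "Q a b \<longleftrightarrow> (\<forall>y z c d. y \<in> F \<longrightarrow> z \<in> F \<longrightarrow>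
        path_between (W y) y (p a) c \<longrightarrow> path_between (W z) z (p b) d \<longrightarrow>
        ?\<Phi> c \<otimes>\<^bsub>?\<pi>\<^esub> ?\<Phi> (path_piece a b p) \<otimes>\<^bsub>?\<pi>\<^esub> inv\<^bsub>?\<pi>\<^esub> ?\<Phi> d \<in> H)" for a b
      have pp: "path p" "path_image p \<subseteq> X"
        using p by (auto simp: path_between_def)
      have sub: "path_between X (p a) (p b) (path_piece a b p)" if "0 \<le> a" "a \<le> b" "b \<le> 1" for a b
        using that pp by (intro path_between_path_piece) (auto simp: path_image_def)
      have nearby: "\<exists>y\<in>F. \<exists>\<delta>>0. \<forall>s\<in>{0..1}. dist s t < \<delta> \<longrightarrow> p s \<in> W y" if t: "t \<in> {0..1}" for t
      proof -
        have pt: "p s \<in> X" if "s \<in> {0..1}" for s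
          using pp that by (auto simp: path_image_def)
        then obtain y where y: "y \<in> F" "p t \<in> V y"
          using F(3) t by blast
        then obtain r where r: "r > 0" "ball (p t) r \<subseteq> V y"
          using V(1) F(1) by (meson openE subsetD)
        obtain \<delta> where "\<delta> > 0" "\<forall>s\<in>{0..1}. dist s t < \<delta> \<longrightarrow> dist (p s) (p t) < r"
          using pp(1) t r(1) unfolding path_def continuous_on_iff by meson
        then have "\<forall>s\<in>{0..1}. dist s t < \<delta> \<longrightarrow> p s \<in> W y"
          using r(2) pt by (auto simp: W_def dist_commute)
        then show ?thesis using y \<open>\<delta> > 0\<close> by blast
      qed
      \<comment> \<open>\<open>Bolzano\<close> performs the subdivision: it suffices that the
        property passes from two adjacent intervals to their union and holds on all short intervals
        around each point. The guard keeps the subintervals within the domain of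
        \<open>p\<close>.\<close>
      have "0 \<le> (0::real) \<and> (1::real) \<le> 1 \<longrightarrow> Q 0 1"
      proof (rule Bolzano[of 0 1 "\<lambda>a b. 0 \<le> a \<and> b \<le> 1 \<longrightarrow> Q a b"])
        fix a b c :: real
        assume ab: "0 \<le> a \<and> b \<le> 1 \<longrightarrow> Q a b" and bc: "0 \<le> b \<and> c \<le> 1 \<longrightarrow> Q b c"
          and le: "a \<le> b" "b \<le> c"
        show "0 \<le> a \<and> c \<le> 1 \<longrightarrow> Q a c"
          unfolding Q_def
        proof (intro impI allI)
          fix y z k l assume ac: "0 \<le> a \<and> c \<le> 1" and yz: "y \<in> F" "z \<in> F"
            and k: "path_between (W y) y (p a) k" and l: "path_between (W z) z (p c) l"
          obtain w where w: "w \<in> F" "p b \<in> W w"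
            using nearby[of b] ac le by force
          have "w \<in> W w"
            using w F(1) V(2) by (auto simp: W_def)
          then obtain m where m: "path_between (W w) w (p b) m"
            using path_between_exists[of "W w" w "p b"] w V(3) F(1) by (auto simp: W_def)
          have 1: "?\<Phi> k \<otimes>\<^bsub>?\<pi>\<^esub> ?\<Phi> (path_piece a b p) \<otimes>\<^bsub>?\<pi>\<^esub> inv\<^bsub>?\<pi>\<^esub> ?\<Phi> m \<in> H"
            using ab ac le yz w k m unfolding Q_def by (meson order_trans)
          have 2: "?\<Phi> m \<otimes>\<^bsub>?\<pi>\<^esub> ?\<Phi> (path_piece b c p) \<otimes>\<^bsub>?\<pi>\<^esub> inv\<^bsub>?\<pi>\<^esub> ?\<Phi> l \<in> H"
            using bc ac le yz w l m unfolding Q_def by (meson order_trans)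
          have S: "path_between X (p a) (p b) (path_piece a b p)" "path_between X (p b) (p c) (path_piece b c p)"
            using ac le by (auto intro!: sub)
          have "?\<Phi> (path_piece a c p) = ?\<Phi> (path_piece a b p +++ path_piece b c p)"
            using ac le by (intro path_class_cong[OF path_between_join[OF S], symmetric]
                homotopic_paths_join_path_pieces pp) auto
          also have "\<dots> = ?\<Phi> (path_piece a b p) \<otimes>\<^bsub>?\<pi>\<^esub> ?\<Phi> (path_piece b c p)"
            by (rule path_class_join[OF S])
          \<comment> \<open>The inverse of \<open>?\<Phi> m\<close> meets \<open>?\<Phi> m\<close>
            in the middle, so the product telescopes.\<close>
          finally have "?\<Phi> k \<otimes>\<^bsub>?\<pi>\<^esub> ?\<Phi> (path_piece a c p) \<otimes>\<^bsub>?\<pi>\<^esub> inv\<^bsub>?\<pi>\<^esub> ?\<Phi> l =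
              (?\<Phi> k \<otimes>\<^bsub>?\<pi>\<^esub> ?\<Phi> (path_piece a b p) \<otimes>\<^bsub>?\<pi>\<^esub> inv\<^bsub>?\<pi>\<^esub> ?\<Phi> m) \<otimes>\<^bsub>?\<pi>\<^esub>
              (?\<Phi> m \<otimes>\<^bsub>?\<pi>\<^esub> ?\<Phi> (path_piece b c p) \<otimes>\<^bsub>?\<pi>\<^esub> inv\<^bsub>?\<pi>\<^esub> ?\<Phi> l)"
            using \<Phi>_closed(1)[OF k] \<Phi>_closed(1)[OF l] \<Phi>_closed(1)[OF m]
              path_class_closed[OF S(1)] path_class_closed[OF S(2)]
            by (simp add: m_assoc flip: m_assoc[of "inv\<^bsub>?\<pi>\<^esub> _"])
          then show "?\<Phi> k \<otimes>\<^bsub>?\<pi>\<^esub> ?\<Phi> (path_piece a c p) \<otimes>\<^bsub>?\<pi>\<^esub> inv\<^bsub>?\<pi>\<^esub> ?\<Phi> l \<in> H"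
            using H.m_closed[OF 1 2] by simp
        qed
      next
        fix t :: real assume t: "0 \<le> t" "t \<le> 1"
        then obtain w \<delta> where w: "w \<in> F" "\<delta> > 0" "\<And>s. s \<in> {0..1} \<Longrightarrow> dist s t < \<delta> \<Longrightarrow> p s \<in> W w"
          using nearby[of t] by fastforce
        have "Q a b" if ab: "0 \<le> a" "a \<le> t" "t \<le> b" "b \<le> 1" "b - a < \<delta>" for a b
          unfolding Q_def
        proof (intro impI allI)
          fix y z k l assume yz: "y \<in> F" "z \<in> F"
            and k: "path_between (W y) y (p a) k" and l: "path_between (W z) z (p b) l"
          have "p ` {a..b} \<subseteq> W w"
            using ab by (auto simp: dist_real_def intro!: w(3))
          then have s: "path_between (W w) (p a) (p b) (path_piece a b p)" and "p a \<in> W w"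
            using ab by (auto intro!: path_between_path_piece pp)
          moreover have "w \<in> W w"
            using w F(1) V(2) by (auto simp: W_def)
          ultimately obtain m where m: "path_between (W w) w (p a) m"
            using path_between_exists[of "W w" w "p a"] w V(3) F(1) by (auto simp: W_def)
          \<comment> \<open>The piece stays in \<open>W w\<close>, so \<open>m\<close> and
            \<open>m +++ path_piece a b p\<close> both run in this one set from its centre
            \<open>w\<close>. Comparing them with \<open>k\<close> and \<open>l\<close> by
            \<open>coset_eq\<close> puts the two factors into \<open>H\<close>.\<close>
          have "?\<Phi> (m +++ path_piece a b p) = ?\<Phi> m \<otimes>\<^bsub>?\<pi>\<^esub> ?\<Phi> (path_piece a b p)"
            by (rule path_class_join[OF to_X(1)[OF m] to_X(1)[OF s]])
          then have "?\<Phi> k \<otimes>\<^bsub>?\<pi>\<^esub> ?\<Phi> (path_piece a b p) \<otimes>\<^bsub>?\<pi>\<^esub> inv\<^bsub>?\<pi>\<^esub> ?\<Phi> l =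
            (?\<Phi> k \<otimes>\<^bsub>?\<pi>\<^esub> inv\<^bsub>?\<pi>\<^esub> ?\<Phi> m) \<otimes>\<^bsub>?\<pi>\<^esub> (?\<Phi> (m +++ path_piece a b p) \<otimes>\<^bsub>?\<pi>\<^esub> inv\<^bsub>?\<pi>\<^esub> ?\<Phi> l)"
            using \<Phi>_closed(1)[OF k] \<Phi>_closed(1)[OF l] \<Phi>_closed(1)[OF m] \<Phi>_closed(1)[OF s]
            by (simp add: m_assoc flip: m_assoc[of "inv\<^bsub>?\<pi>\<^esub> _"])
          moreover have "?\<Phi> k \<otimes>\<^bsub>?\<pi>\<^esub> inv\<^bsub>?\<pi>\<^esub> ?\<Phi> m \<in> H"
            by (rule coset_eq[OF yz(1) w(1) k m])
          moreover have "?\<Phi> (m +++ path_piece a b p) \<otimes>\<^bsub>?\<pi>\<^esub> inv\<^bsub>?\<pi>\<^esub> ?\<Phi> l \<in> H"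
            by (rule coset_eq[OF w(1) yz(2) path_between_join[OF m s] l])
          ultimately show "?\<Phi> k \<otimes>\<^bsub>?\<pi>\<^esub> ?\<Phi> (path_piece a b p) \<otimes>\<^bsub>?\<pi>\<^esub> inv\<^bsub>?\<pi>\<^esub> ?\<Phi> l \<in> H"
            by simp
        qed
        then show "\<exists>d>0. \<forall>a b. a \<le> t \<and> t \<le> b \<and> b - a < d \<longrightarrow> 0 \<le> a \<and> b \<le> 1 \<longrightarrow> Q a b"
          using w(2) by blast
      qed simp
      then have "Q 0 1" by simp
      then show ?thesis
        using yz c d unfolding Q_def by (simp add: path_piece_def subpath_trivial)
    qed
    have "A \<in> H" if A: "A \<in> carrier ?\<pi>" for A
    proof -
      obtain p where p: "p \<in> loops X x" "A = loop_class X x p"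
        using A by (rule carrier_fundamental_groupE)
      then have px: "path_between X x x p" and e: "p 0 = x" "p 1 = x"
        by (auto simp: loops_def path_between_def pathstart_def pathfinish_def)
      obtain y where y: "y \<in> F" "x \<in> W y"
        using F(3) basepoint by (auto simp: W_def)
      then obtain c where c: "path_between (W y) y x c"
        using path_between_exists[of "W y" y x] V(2,3) F(1) by (auto simp: W_def)
      \<comment> \<open>With the same \<open>c\<close> at both ends \<open>path_in_H\<close> yields
        a conjugate of \<open>A\<close>, and normality removes \<open>c\<close>.\<close>
      have "?\<Phi> c \<otimes>\<^bsub>?\<pi>\<^esub> ?\<Phi> p \<otimes>\<^bsub>?\<pi>\<^esub> inv\<^bsub>?\<pi>\<^esub> ?\<Phi> c \<in> H"
        using path_in_H[of p y y c c] px y c by (simp add: e)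
      from H.inv_op_closed1[OF \<Phi>_closed(1)[OF c] this] show "A \<in> H"
        using \<Phi>_closed(1)[OF c] path_class_closed[OF px] path_class_loop[OF px] p(2)
        by (simp add: m_assoc flip: m_assoc[of "inv\<^bsub>?\<pi>\<^esub> _"])
    qed
    then show "H = carrier ?\<pi>"
      using H.subset by blast
  qed
qed

end

section \<open>Category in the Cantor space\<close>

lemma meager_in_UN:
  assumes "\<And>n::nat. meager_in Z (A n)"
  shows "meager_in Z (\<Union>n. A n)"
proof -
  obtain F where F: "\<And>n (i::nat). nowhere_dense_in Z (F n i)" "\<And>n. A n = (\<Union>i. F n i)"
    using assms unfolding meager_in_def by metis
  have "(\<Union>n. A n) = (\<Union>j. F (fst (prod_decode j)) (snd (prod_decode j)))"
  proof (intro equalityI subsetI)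
    fix a assume "a \<in> (\<Union>n. A n)"
    then obtain n i where "a \<in> F n i" using F(2) by auto
    then show "a \<in> (\<Union>j. F (fst (prod_decode j)) (snd (prod_decode j)))"
      by (intro UN_I[of "prod_encode (n, i)"]) auto
  qed (auto simp: F(2))
  then show ?thesis
    unfolding meager_in_def using F(1) by (intro exI[of _ "\<lambda>j. F (fst (prod_decode j)) (snd (prod_decode j))"]) simp
qed

lemma meager_in_Un:
  assumes "meager_in Z A" "meager_in Z B"
  shows "meager_in Z (A \<union> B)"
proof -
  have "A \<union> B = (\<Union>n::nat. if n = 0 then A else B)"
    by (auto split: if_splits)
  then show ?thesis
    using meager_in_UN[of Z "\<lambda>n. if n = 0 then A else B"] assms by simp
qed

lemma meager_in_homeomorphic_image:
  assumes h: "homeomorphic_map Z Z' h" and A: "meager_in Z A"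
  shows "meager_in Z' (h ` A)"
proof -
  obtain F where F: "\<And>n::nat. nowhere_dense_in Z (F n)" "A = (\<Union>n. F n)"
    using A unfolding meager_in_def by blast
  have "nowhere_dense_in Z' (h ` F n)" for n
  proof -
    have sub: "F n \<subseteq> topspace Z" and int: "Z interior_of (Abstract_Topology.closure_of Z (F n)) = {}"
      using F(1)[of n] by (auto simp: nowhere_dense_in_def)
    have "Z' interior_of (Abstract_Topology.closure_of Z' (h ` F n)) = {}"
      using homeomorphic_map_closure_of[OF h sub]
        homeomorphic_map_interior_of[OF h closure_of_subset_topspace] int by simp
    moreover have "h ` F n \<subseteq> topspace Z'"
      using sub homeomorphic_imp_surjective_map[OF h] by blast
    ultimately show ?thesis
      by (simp add: nowhere_dense_in_def)
  qed
  moreover have "h ` A = (\<Union>n. h ` F n)"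
    using F(2) by auto
  ultimately show ?thesis
    unfolding meager_in_def by (intro exI[of _ "\<lambda>n. h ` F n"]) simp
qed

text \<open>This is the Baire category theorem, applied to the closures of the nowhere dense pieces:
  their union has empty interior.\<close>

lemma open_not_subset_meager:
  assumes Z: "completely_metrizable_space Z" and U: "openin Z U" "U \<noteq> {}" and A: "meager_in Z A"
  shows "\<not> U \<subseteq> A"
proof
  assume "U \<subseteq> A"
  obtain F where F: "\<And>n::nat. nowhere_dense_in Z (F n)" "A = (\<Union>n. F n)"
    using A unfolding meager_in_def by blast
  let ?F = "range (\<lambda>n. Abstract_Topology.closure_of Z (F n))"
  have "Z interior_of \<Union>?F = {}"
    using F(1) Z by (intro Baire_category_alt) (auto simp: nowhere_dense_in_def)
  moreover have "F n \<subseteq> Abstract_Topology.closure_of Z (F n)" for n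
    using F(1) by (intro closure_of_subset) (simp add: nowhere_dense_in_def)
  then have "U \<subseteq> \<Union>?F"
    using \<open>U \<subseteq> A\<close> F(2) by blast
  ultimately show False
    using U interior_of_maximal by blast
qed

text \<open>Real rather than Boolean sequences are used because a \<open>pointclass\<close> takes
  values only on topologies of type \<open>(nat \<Rightarrow> real) topology\<close>.\<close>

definition cantor_set :: "(nat \<Rightarrow> real) set"
  where "cantor_set = {\<alpha>. \<forall>n. \<alpha> n \<in> {0, 1}}"

abbreviation cantor_space :: "(nat \<Rightarrow> real) topology"
  where "cantor_space \<equiv> top_of_set cantor_set"

lemma Polish_cantor_space: "Polish_space cantor_space"
proof -
  have "closed cantor_set"
  proof -
    have "closed {\<alpha> :: nat \<Rightarrow> real. \<alpha> n \<in> {0, 1}}" for n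
      using closed_vimage[OF _ continuous_on_product_coordinates[of n], of "{0, 1::real}"]
      by (simp add: vimage_def)
    then have "closed (\<Inter>n. {\<alpha> :: nat \<Rightarrow> real. \<alpha> n \<in> {0, 1}})"
      by (intro closed_INT ballI)
    also have "(\<Inter>n. {\<alpha>. \<alpha> n \<in> {0, 1}}) = cantor_set"
      by (auto simp: cantor_set_def)
    finally show ?thesis .
  qed
  then have "completely_metrizable_space cantor_space"
    by (intro completely_metrizable_space_closedin completely_metrizable_space_euclidean) simp
  moreover have "separable_space cantor_space"
  proof -
    obtain T where T: "countable T" "T \<subseteq> cantor_set" "cantor_set \<subseteq> closure T"
      by (rule separable)
    have "Abstract_Topology.closure_of cantor_space T = cantor_set"
      using T by (auto simp: closure_of_subtopology Int_absorb1 inf_absorb2)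
    then show ?thesis
      using T unfolding separable_space_def by auto
  qed
  ultimately show ?thesis
    by (simp add: Polish_space_def)
qed

section \<open>Cylinders and coordinate flips\<close>

definition cylinder :: "(nat \<Rightarrow> real) \<Rightarrow> nat \<Rightarrow> (nat \<Rightarrow> real) set"
  where "cylinder \<alpha> k = {\<beta> \<in> cantor_set. \<forall>i<k. \<beta> i = \<alpha> i}"

lemma openin_cylinder:
  assumes "\<alpha> \<in> cantor_set"
  shows "openin cantor_space (cylinder \<alpha> k)"
proof -
  have "open {\<beta> :: nat \<Rightarrow> real. \<forall>i\<in>{..<k}. \<beta> (id i) \<in> ball (\<alpha> i) 1}"
    by (intro product_topology_basis') auto
  moreover have "cylinder \<alpha> k = cantor_set \<inter> {\<beta>. \<forall>i\<in>{..<k}. \<beta> (id i) \<in> ball (\<alpha> i) 1}"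
  proof -
    \<comment> \<open>Distinct elements of {0, 1} have distance 1, so open balls of radius 1 detect
      equality.\<close>
    have "\<beta> i = \<alpha> i \<longleftrightarrow> dist (\<alpha> i) (\<beta> i) < 1" if "\<beta> \<in> cantor_set" for \<beta> i
    proof -
      have "\<alpha> i = 0 \<or> \<alpha> i = 1" "\<beta> i = 0 \<or> \<beta> i = 1"
        using assms that by (auto simp: cantor_set_def)
      then show ?thesis by (auto simp: dist_real_def)
    qed
    then show ?thesis by (auto simp: cylinder_def)
  qed
  ultimately show ?thesis
    by (auto simp: openin_open)
qed

lemma cylinder_subset_open:
  assumes "openin cantor_space U" "\<alpha> \<in> U"
  obtains k where "cylinder \<alpha> k \<subseteq> U"
proof -
  obtain T where T: "open T" "U = cantor_set \<inter> T"
    using assms(1) by (auto simp: openin_open)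
  then have "openin (product_topology (\<lambda>i::nat. euclidean :: real topology) UNIV) T"
    by (simp add: open_fun_def)
  then obtain V where V: "finite {i. V i \<noteq> (UNIV :: real set)}" "\<alpha> \<in> Pi\<^sub>E UNIV V" "Pi\<^sub>E UNIV V \<subseteq> T"
    using assms(2) T(2) unfolding openin_product_topology_alt by fastforce
  obtain k where k: "\<And>i. V i \<noteq> UNIV \<Longrightarrow> i < k"
    using finite_nat_set_iff_bounded V(1) by auto
  have "cylinder \<alpha> k \<subseteq> U"
  proof
    fix \<beta> assume \<beta>: "\<beta> \<in> cylinder \<alpha> k"
    have "\<beta> i \<in> V i" for i
      using k[of i] V(2) \<beta> by (cases "V i = UNIV") (auto simp: cylinder_def PiE_iff)
    then have "\<beta> \<in> T" using V(3) by (auto simp: PiE_iff)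
    then show "\<beta> \<in> U" using \<beta> T(2) by (simp add: cylinder_def)
  qed
  then show ?thesis by (rule that)
qed

definition flip :: "nat \<Rightarrow> (nat \<Rightarrow> real) \<Rightarrow> nat \<Rightarrow> real"
  where "flip m \<alpha> = \<alpha>(m := 1 - \<alpha> m)"

lemma flip_flip [simp]: "flip m (flip m \<alpha>) = \<alpha>"
  by (auto simp: flip_def)

lemma flip_in_cantor_set: "\<alpha> \<in> cantor_set \<Longrightarrow> flip m \<alpha> \<in> cantor_set"
  by (auto simp: flip_def cantor_set_def)

lemma homeomorphic_map_flip: "homeomorphic_map cantor_space cantor_space (flip m)"
proof -
  have coord: "continuous_on cantor_set (\<lambda>\<alpha>. \<alpha> i)" for i :: nat
    by (rule continuous_on_subset[OF continuous_on_product_coordinates]) simp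
  have "continuous_on cantor_set (\<lambda>\<alpha>. flip m \<alpha> i)" for i
    using coord by (cases "i = m") (auto simp: flip_def intro!: continuous_intros)
  then have "continuous_on cantor_set (flip m)"
    by (rule continuous_on_coordinatewise_then_product)
  then have "homeomorphic_maps cantor_space cantor_space (flip m) (flip m)"
    by (auto simp: homeomorphic_maps_def flip_in_cantor_set)
  then show ?thesis
    using homeomorphic_maps_map by blast
qed

text \<open>By Baire category some \<open>A n\<close> is comeager in a nonempty open set, hence in a
  cylinder fixing the first \<open>k\<close> coordinates. For \<open>m \<ge> k\<close>, flipping
  coordinate \<open>m\<close> is a homeomorphism that preserves this cylinder, so a generic point of
  it and its flip both lie in \<open>A n\<close>. The indices \<open>n\<close> and \<open>k\<close>
  do not depend on \<open>m\<close>.\<close>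

lemma cantor_cover_flip:
  assumes BP: "\<And>n::nat. Baire_property_in cantor_space (A n)" and cover: "(\<Union>n. A n) = cantor_set"
  obtains n k where "\<And>m. m \<ge> k \<Longrightarrow> \<exists>\<alpha>\<in>A n. flip m \<alpha> \<in> A n"
proof -
  have complete: "completely_metrizable_space cantor_space"
    using Polish_cantor_space by (simp add: Polish_space_def)
  obtain U where U: "\<And>n. openin cantor_space (U n)"
    "\<And>n. meager_in cantor_space ((A n - U n) \<union> (U n - A n))"
    using BP unfolding Baire_property_in_def by metis
  obtain n \<alpha> where "\<alpha> \<in> U n"
  proof (rule ccontr)
    assume "\<not> thesis"
    then have "U n = {}" for n
      using that by blast
    then have "meager_in cantor_space (A n)" for n
      using U(2)[of n] by simp
    then have "meager_in cantor_space cantor_set"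
      using meager_in_UN[of cantor_space A] cover by simp
    moreover have "cantor_set \<noteq> {}"
      by (auto simp: cantor_set_def intro: exI[of _ "\<lambda>_. 0"])
    ultimately show False
      using open_not_subset_meager[OF complete, of cantor_set cantor_set] by simp
  qed
  then obtain k where k: "cylinder \<alpha> k \<subseteq> U n"
    using cylinder_subset_open U(1) by blast
  have \<alpha>: "\<alpha> \<in> cantor_set"
    using \<open>\<alpha> \<in> U n\<close> openin_imp_subset[OF U(1)] by blast
  define M where "M = (A n - U n) \<union> (U n - A n)"
  show ?thesis
  proof (rule that[of k n])
    fix m assume m: "k \<le> m"
    have "meager_in cantor_space (M \<union> flip m ` M)"
      unfolding M_def using U(2)[of n] meager_in_Un meager_in_homeomorphic_image homeomorphic_map_flip by blast
    moreover have "cylinder \<alpha> k \<noteq> {}"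
      using \<alpha> by (auto simp: cylinder_def)
    ultimately obtain \<beta> where \<beta>: "\<beta> \<in> cylinder \<alpha> k" "\<beta> \<notin> M" "\<beta> \<notin> flip m ` M"
      using open_not_subset_meager[OF complete openin_cylinder[OF \<alpha>]] by blast
    have "flip m \<beta> \<in> cylinder \<alpha> k"
      using \<beta>(1) m flip_in_cantor_set by (auto simp: cylinder_def flip_def)
    moreover have "flip m \<beta> \<notin> M"
      using \<beta>(3) by (metis flip_flip imageI)
    ultimately show "\<exists>\<alpha>\<in>A n. flip m \<alpha> \<in> A n"
      using \<beta>(1,2) k unfolding M_def by blast
  qed
qed

section \<open>Infinite concatenations of shrinking loops\<close>

text \<open>Nesting to the right puts \<open>g n\<close> on the interval from
  \<open>1 - 1/2^n\<close> to \<open>1 - 1/2^(n+1)\<close> and lets the path rest at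
  \<open>y\<close> after the last factor. Raising \<open>k\<close> therefore changes only the final
  stretch of length \<open>1/2^k\<close>.\<close>

primrec finite_concat :: "'a::metric_space \<Rightarrow> nat \<Rightarrow> (nat \<Rightarrow> real \<Rightarrow> 'a) \<Rightarrow> real \<Rightarrow> 'a"
  where
    "finite_concat y 0 g = (\<lambda>_. y)"
  | "finite_concat y (Suc k) g = g 0 +++ finite_concat y k (g \<circ> Suc)"

text \<open>Taking a limit avoids dyadic case distinctions: estimates and the recursion are proved
  for finite concatenations and then passed to the limit.\<close>

definition infinite_concat :: "'a::metric_space \<Rightarrow> (nat \<Rightarrow> real \<Rightarrow> 'a) \<Rightarrow> real \<Rightarrow> 'a"
  where "infinite_concat y g t = lim (\<lambda>k. finite_concat y k g t)"

definition shrinking_loops :: "'a::metric_space set \<Rightarrow> 'a \<Rightarrow> (nat \<Rightarrow> real \<Rightarrow> 'a) \<Rightarrow> bool"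
  where "shrinking_loops X y g \<longleftrightarrow> y \<in> X \<and> (\<forall>n. path_between X y y (g n)) \<and>
    (\<forall>\<epsilon>>0. \<exists>k. \<forall>n\<ge>k. path_image (g n) \<subseteq> cball y \<epsilon>)"

lemma shrinking_loops_Suc: "shrinking_loops X y g \<Longrightarrow> shrinking_loops X y (g \<circ> Suc)"
  unfolding shrinking_loops_def by (metis comp_apply le_SucI)

lemma finite_concat_cong:
  assumes "\<And>n. n < k \<Longrightarrow> g n = h n"
  shows "finite_concat y k g = finite_concat y k h"
  using assms
proof (induction k arbitrary: g h)
  case (Suc k)
  have "finite_concat y k (g \<circ> Suc) = finite_concat y k (h \<circ> Suc)"
    by (rule Suc.IH) (simp add: Suc.prems)
  then show ?case
    using Suc.prems[of 0] by simp
qed simp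

lemma path_between_finite_concat:
  assumes "y \<in> X" "\<And>n. path_between X y y (g n)"
  shows "path_between X y y (finite_concat y k g)"
  using assms(2)
proof (induction k arbitrary: g)
  case (Suc k)
  have "path_between X y y (finite_concat y k (g \<circ> Suc))"
    by (rule Suc.IH) (simp add: Suc.prems)
  then show ?case
    using path_between_join[OF Suc.prems] by simp
qed (simp add: path_between_const[OF assms(1)])

lemma dist_finite_concat_basepoint:
  assumes "\<And>n. path_image (g n) \<subseteq> cball y \<epsilon>" "0 \<le> \<epsilon>" "t \<in> {0..1}"
  shows "dist y (finite_concat y m g t) \<le> \<epsilon>"
  using assms
proof (induction m arbitrary: g t)
  case (Suc m)
  show ?case
  proof (cases "t \<le> 1 / 2")
    case True
    then have "g 0 (2 * t) \<in> path_image (g 0)"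
      using Suc.prems(3) by (auto simp: path_image_def)
    then show ?thesis
      using True Suc.prems(1)[of 0] by (auto simp: joinpaths_def)
  next
    case False
    have "dist y (finite_concat y m (g \<circ> Suc) (2 * t - 1)) \<le> \<epsilon>"
      using False Suc.prems by (intro Suc.IH) auto
    then show ?thesis
      using False by (simp add: joinpaths_def)
  qed
qed simp

text \<open>The two paths agree except on the last dyadic interval, where the first rests at
  \<open>y\<close> and the second follows loops within \<open>\<epsilon>\<close> of
  \<open>y\<close>. The induction strips the \<open>k\<close> common factors.\<close>

lemma dist_finite_concat:
  assumes "\<And>n. n \<ge> k \<Longrightarrow> path_image (g n) \<subseteq> cball y \<epsilon>" "0 \<le> \<epsilon>" "t \<in> {0..1}"
  shows "dist (finite_concat y k g t) (finite_concat y (k + m) g t) \<le> \<epsilon>"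
  using assms
proof (induction k arbitrary: g t)
  case 0
  then show ?case
    using dist_finite_concat_basepoint[of g y \<epsilon> t m] by simp
next
  case (Suc k)
  show ?case
  proof (cases "t \<le> 1 / 2")
    case False
    have "dist (finite_concat y k (g \<circ> Suc) (2 * t - 1))
        (finite_concat y (k + m) (g \<circ> Suc) (2 * t - 1)) \<le> \<epsilon>"
      using False Suc.prems by (intro Suc.IH) auto
    then show ?thesis
      using False by (simp add: joinpaths_def)
  qed (use Suc.prems in \<open>simp add: joinpaths_def\<close>)
qed

context
  fixes X :: "'a::metric_space set" and y :: 'a
  assumes compact: "compact X"
begin

text \<open>Compactness enters through completeness: the preceding estimate makes the sequence
  Cauchy, and completeness of \<open>X\<close> supplies a limit in \<open>X\<close>.\<close>

lemma finite_concat_tendsto: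
  assumes g: "shrinking_loops X y g" and t: "t \<in> {0..1}"
  shows "(\<lambda>k. finite_concat y k g t) \<longlonglongrightarrow> infinite_concat y g t" "infinite_concat y g t \<in> X"
proof -
  have cauchy: "Cauchy (\<lambda>k. finite_concat y k g t)"
  proof (rule metric_CauchyI)
    fix e :: real assume "0 < e"
    then obtain k where k: "\<And>n. n \<ge> k \<Longrightarrow> path_image (g n) \<subseteq> cball y (e / 3)"
      using g unfolding shrinking_loops_def by (meson divide_pos_pos zero_less_numeral)
    have *: "dist (finite_concat y k g t) (finite_concat y m g t) \<le> e / 3" if "m \<ge> k" for m
      using dist_finite_concat[of k g y "e / 3" t "m - k"] k t that \<open>0 < e\<close> by simp
    have "dist (finite_concat y m g t) (finite_concat y n g t) < e" if "m \<ge> k" "n \<ge> k" for m n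
      using *[OF that(1)] *[OF that(2)] \<open>0 < e\<close>
        dist_triangle3[of "finite_concat y m g t" "finite_concat y n g t" "finite_concat y k g t"]
      by linarith
    then show "\<exists>M. \<forall>m\<ge>M. \<forall>n\<ge>M. dist (finite_concat y m g t) (finite_concat y n g t) < e"
      by blast
  qed
  have in_X: "\<forall>k. finite_concat y k g t \<in> X"
    using path_between_finite_concat[of y X g] g t
    unfolding shrinking_loops_def path_between_def path_image_def by blast
  obtain l where l: "l \<in> X" "(\<lambda>k. finite_concat y k g t) \<longlonglongrightarrow> l"
    by (rule completeE[OF compact_imp_complete[OF compact] in_X cauchy])
  have "infinite_concat y g t = l"
    unfolding infinite_concat_def by (rule limI[OF l(2)])
  then show "(\<lambda>k. finite_concat y k g t) \<longlonglongrightarrow> infinite_concat y g t" "infinite_concat y g t \<in> X"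
    using l by auto
qed

lemma dist_finite_infinite_concat:
  assumes g: "shrinking_loops X y g" and t: "t \<in> {0..1}" and "0 \<le> \<epsilon>"
    and k: "\<And>n. n \<ge> k \<Longrightarrow> path_image (g n) \<subseteq> cball y \<epsilon>"
  shows "dist (finite_concat y k g t) (infinite_concat y g t) \<le> \<epsilon>"
proof (rule LIMSEQ_le_const2)
  show "(\<lambda>m. dist (finite_concat y k g t) (finite_concat y m g t))
      \<longlonglongrightarrow> dist (finite_concat y k g t) (infinite_concat y g t)"
    by (intro tendsto_intros finite_concat_tendsto[OF g t])
  have "dist (finite_concat y k g t) (finite_concat y m g t) \<le> \<epsilon>" if "m \<ge> k" for m
    using dist_finite_concat[of k g y \<epsilon> t "m - k"] assms that by simp
  then show "\<exists>N. \<forall>n\<ge>N. dist (finite_concat y k g t) (finite_concat y n g t) \<le> \<epsilon>"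
    by blast
qed

lemma path_between_infinite_concat:
  assumes g: "shrinking_loops X y g"
  shows "path_between X y y (infinite_concat y g)"
proof -
  have fin: "path_between X y y (finite_concat y k g)" for k
    using path_between_finite_concat g by (auto simp: shrinking_loops_def)
  \<comment> \<open>The bound does not depend on \<open>t\<close>, so the convergence is uniform and
    continuity passes to the limit.\<close>
  have "uniform_limit {0..1} (\<lambda>k. finite_concat y k g) (infinite_concat y g) sequentially"
  proof (rule uniform_limitI)
    fix e :: real assume "0 < e"
    then obtain k where k: "\<And>n. n \<ge> k \<Longrightarrow> path_image (g n) \<subseteq> cball y (e / 2)"
      using g unfolding shrinking_loops_def by (meson half_gt_zero)
    have "dist (finite_concat y m g t) (infinite_concat y g t) < e"
      if "m \<ge> k" "t \<in> {0..1}" for m t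
    proof -
      have "dist (finite_concat y m g t) (infinite_concat y g t) \<le> e / 2"
        using \<open>0 < e\<close> k that by (intro dist_finite_infinite_concat[OF g]) auto
      then show ?thesis using \<open>0 < e\<close> by simp
    qed
    then show "\<forall>\<^sub>F m in sequentially. \<forall>t\<in>{0..1}. dist (finite_concat y m g t) (infinite_concat y g t) < e"
      unfolding eventually_sequentially by blast
  qed
  then have "continuous_on {0..1} (infinite_concat y g)"
    by (rule uniform_limit_theorem[rotated])
      (use fin in \<open>auto simp: path_between_def path_def\<close>)
  moreover have "infinite_concat y g t = y" if "t \<in> {0, 1}" for t
  proof -
    have "finite_concat y k g t = y" for k
      using fin[of k] that by (auto simp: path_between_def pathstart_def pathfinish_def)
    then show ?thesis
      by (simp add: infinite_concat_def)
  qed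
  ultimately show ?thesis
    using finite_concat_tendsto(2)[OF g]
    by (auto simp: path_between_def path_def path_image_def pathstart_def pathfinish_def)
qed

text \<open>The recursion of \<open>finite_concat\<close> survives the limit. Equality on the unit
  interval is all that \<open>path_class_cong_on\<close> asks for.\<close>

lemma infinite_concat_Suc:
  assumes g: "shrinking_loops X y g" and t: "t \<in> {0..1}"
  shows "infinite_concat y g t = (g 0 +++ infinite_concat y (g \<circ> Suc)) t"
proof -
  have "(\<lambda>k. finite_concat y (Suc k) g t) \<longlonglongrightarrow> (g 0 +++ infinite_concat y (g \<circ> Suc)) t"
  proof (cases "t \<le> 1 / 2")
    case False
    then show ?thesis
      using finite_concat_tendsto(1)[OF shrinking_loops_Suc[OF g], of "2 * t - 1"] t
      by (simp add: joinpaths_def)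
  qed (simp add: joinpaths_def)
  moreover have "(\<lambda>k. finite_concat y (Suc k) g t) \<longlonglongrightarrow> infinite_concat y g t"
    using finite_concat_tendsto(1)[OF g t] by (rule LIMSEQ_Suc)
  ultimately show ?thesis
    using LIMSEQ_unique by blast
qed

end

lemma (in path_connected_space) path_class_infinite_concat_Suc:
  assumes "compact X" and g: "shrinking_loops X y g"
  shows "path_class X x (infinite_concat y g) =
    path_class X x (g 0) \<otimes>\<^bsub>fundamental_group X x\<^esub> path_class X x (infinite_concat y (g \<circ> Suc))"
proof -
  have "path_class X x (infinite_concat y g) = path_class X x (g 0 +++ infinite_concat y (g \<circ> Suc))"
    using assms infinite_concat_Suc by (intro path_class_cong_on[OF path_between_infinite_concat]) auto
  also have "\<dots> = path_class X x (g 0) \<otimes>\<^bsub>fundamental_group X x\<^esub> path_class X x (infinite_concat y (g \<circ> Suc))"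
    using g path_between_infinite_concat[OF assms(1) shrinking_loops_Suc[OF g]]
    by (intro path_class_join[of y y _ y]) (auto simp: shrinking_loops_def)
  finally show ?thesis .
qed

lemma shrinking_loops_update:
  assumes g: "shrinking_loops X y g"
  shows "shrinking_loops X y (g(m := \<lambda>_. y))"
  unfolding shrinking_loops_def
proof (intro conjI allI impI)
  show y: "y \<in> X" using g by (simp add: shrinking_loops_def)
  show "path_between X y y ((g(m := \<lambda>_. y)) n)" for n
    using g path_between_const[OF y] by (simp add: shrinking_loops_def)
  fix \<epsilon> :: real assume "\<epsilon> > 0"
  then obtain k where "\<forall>n\<ge>k. path_image (g n) \<subseteq> cball y \<epsilon>"
    using g unfolding shrinking_loops_def by blast
  then show "\<exists>k. \<forall>n\<ge>k. path_image ((g(m := \<lambda>_. y)) n) \<subseteq> cball y \<epsilon>"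
    using \<open>\<epsilon> > 0\<close> by (intro exI[of _ k]) (auto simp: path_image_def)
qed

text \<open>If \<open>a\<close> is the product of the classes before place \<open>m\<close>,
  \<open>b\<close> the class of \<open>g m\<close> and \<open>r\<close> that of the tail, the
  quotient is a b r (a r)^-1 = a b a^-1, a conjugate of \<open>b\<close>. The induction removes the
  factors of \<open>a\<close> one at a time by conjugation.\<close>

lemma (in path_connected_space) erased_factor_in_normal:
  assumes X: "compact X" and N: "N \<lhd> fundamental_group X x"
    and g: "shrinking_loops X y g"
    and quot: "path_class X x (infinite_concat y g) \<otimes>\<^bsub>fundamental_group X x\<^esub>
      inv\<^bsub>fundamental_group X x\<^esub> path_class X x (infinite_concat y (g(m := \<lambda>_. y))) \<in> N"
  shows "path_class X x (g m) \<in> N"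
  using g quot
proof (induction m arbitrary: g)
  case 0
  let ?\<pi> = "fundamental_group X x"
  let ?h = "g(0 := \<lambda>_. y)" and ?R = "path_class X x (infinite_concat y (g \<circ> Suc))"
  have h: "shrinking_loops X y ?h"
    using shrinking_loops_update[OF 0(1)] .
  have tail: "?h \<circ> Suc = g \<circ> Suc" by auto
  have R: "?R \<in> carrier ?\<pi>"
    using path_class_closed path_between_infinite_concat[OF X] shrinking_loops_Suc[OF 0(1)] by blast
  have "path_class X x (g 0) \<in> carrier ?\<pi>" "y \<in> X"
    using 0(1) path_class_closed by (auto simp: shrinking_loops_def)
  moreover have "path_class X x (infinite_concat y g) \<otimes>\<^bsub>?\<pi>\<^esub> inv\<^bsub>?\<pi>\<^esub> path_class X x (infinite_concat y ?h) \<in> N"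
    by (rule 0(2))
  ultimately show ?case
    using R path_class_infinite_concat_Suc[OF X 0(1)] path_class_infinite_concat_Suc[OF X h]
    unfolding tail by (simp add: path_class_const m_assoc)
next
  case (Suc m)
  let ?\<pi> = "fundamental_group X x"
  interpret N: normal N ?\<pi> by (rule N)
  let ?h = "g(Suc m := \<lambda>_. y)"
  let ?R = "path_class X x (infinite_concat y (g \<circ> Suc))"
    and ?S = "path_class X x (infinite_concat y ((g \<circ> Suc)(m := \<lambda>_. y)))"
    and ?a = "path_class X x (g 0)"
  have h: "shrinking_loops X y ?h"
    using shrinking_loops_update[OF Suc(2)] .
  have tail: "?h \<circ> Suc = (g \<circ> Suc)(m := \<lambda>_. y)" "?h 0 = g 0" by auto
  note gS = shrinking_loops_Suc[OF Suc(2)]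
  have c: "?R \<in> carrier ?\<pi>" "?S \<in> carrier ?\<pi>" "?a \<in> carrier ?\<pi>"
    using path_class_closed path_between_infinite_concat[OF X] gS
      shrinking_loops_update[OF gS] Suc(2) unfolding shrinking_loops_def[of X y g] by blast+
  have "path_class X x (infinite_concat y g) \<otimes>\<^bsub>?\<pi>\<^esub> inv\<^bsub>?\<pi>\<^esub> path_class X x (infinite_concat y ?h) \<in> N"
    by (rule Suc(3))
  then have "?a \<otimes>\<^bsub>?\<pi>\<^esub> ?R \<otimes>\<^bsub>?\<pi>\<^esub> inv\<^bsub>?\<pi>\<^esub> (?a \<otimes>\<^bsub>?\<pi>\<^esub> ?S) \<in> N"
    using path_class_infinite_concat_Suc[OF X Suc(2)] path_class_infinite_concat_Suc[OF X h]
    unfolding tail by simp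
  from N.inv_op_closed1[OF c(3) this] have RS: "?R \<otimes>\<^bsub>?\<pi>\<^esub> inv\<^bsub>?\<pi>\<^esub> ?S \<in> N"
    using c by (simp add: inv_mult_group m_assoc flip: m_assoc[of "inv\<^bsub>?\<pi>\<^esub> _"])
  have "path_class X x ((g \<circ> Suc) m) \<in> N"
    by (rule Suc.IH[OF gS RS])
  then show ?case by simp
qed

section \<open>The category argument\<close>

lemma continuous_map_into_loop_topology:
  assumes L: "\<And>\<alpha>. \<alpha> \<in> cantor_set \<Longrightarrow> L \<alpha> \<in> loops X x"
    and close: "\<And>\<epsilon>. \<epsilon> > 0 \<Longrightarrow> \<exists>k. \<forall>\<alpha>\<in>cantor_set. \<forall>\<beta>\<in>cylinder \<alpha> k.
      \<forall>t\<in>{0..1}. dist (L \<alpha> t) (L \<beta> t) \<le> \<epsilon>"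
  shows "continuous_map cantor_space (loop_topology X x) L"
proof -
  interpret M: Metric_space "loops X x" "mdist (loop_metric X x)"
    using Metric_space_mspace_mdist[of "loop_metric X x"] by simp
  have top: "loop_topology X x = M.mtopology"
    by (simp add: loop_topology_def mtopology_of_def)
  show ?thesis
    unfolding top M.continuous_map_to_metric
  proof (intro ballI allI impI)
    fix \<alpha> and \<epsilon> :: real assume "\<alpha> \<in> topspace cantor_space" "\<epsilon> > 0"
    then have \<alpha>: "\<alpha> \<in> cantor_set" by simp
    \<comment> \<open>Pointwise bounds give only a non-strict bound on the supremum; halving
      \<open>\<epsilon>\<close> makes it strict.\<close>
    obtain k where k: "\<And>\<beta> t. \<beta> \<in> cylinder \<alpha> k \<Longrightarrow> t \<in> {0..1} \<Longrightarrow> dist (L \<alpha> t) (L \<beta> t) \<le> \<epsilon> / 2"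
      using close[OF half_gt_zero[OF \<open>\<epsilon> > 0\<close>]] \<alpha> by blast
    have "L \<beta> \<in> M.mball (L \<alpha>) \<epsilon>" if \<beta>: "\<beta> \<in> cylinder \<alpha> k" for \<beta>
    proof -
      have \<beta>': "\<beta> \<in> cantor_set" using \<beta> by (simp add: cylinder_def)
      have "mdist (loop_metric X x) (L \<alpha>) (L \<beta>) \<le> \<epsilon> / 2"
        unfolding mdist_loop_metric[OF L[OF \<alpha>] L[OF \<beta>']] using k[OF \<beta>] by (intro cSUP_least) auto
      then show ?thesis
        using L[OF \<alpha>] L[OF \<beta>'] \<open>\<epsilon> > 0\<close> by simp
    qed
    moreover have "\<alpha> \<in> cylinder \<alpha> k" using \<alpha> by (simp add: cylinder_def)
    ultimately show "\<exists>U. openin cantor_space U \<and> \<alpha> \<in> U \<and> (\<forall>\<beta>\<in>U. L \<beta> \<in> M.mball (L \<alpha>) \<epsilon>)"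
      using openin_cylinder[OF \<alpha>] by blast
  qed
qed

text \<open>The Baire property alone is not stable under continuous preimages, but \<open>P\<close>
  is. So the set is first pulled back within \<open>P\<close>, through the copy of \<open>Z\<close>,
  and the Baire property is invoked only on \<open>Y\<close>.\<close>

lemma Baire_property_vimage:
  fixes Y :: "(nat \<Rightarrow> real) topology"
  assumes P: "nice_pointclass P" "pointclass_BP P" and A: "of_pointclass P Z A"
    and Y: "Polish_space Y" and L: "continuous_map Y Z L"
  shows "Baire_property_in Y {\<alpha> \<in> topspace Y. L \<alpha> \<in> A}"
proof -
  obtain Z' f where Z': "Polish_space Z'" "homeomorphic_map Z Z' f" "f ` A \<in> P Z'" and "A \<subseteq> topspace Z"
    using A unfolding of_pointclass_def by blast
  have "continuous_map Y Z' (f \<circ> L)"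
    using L Z'(2) continuous_map_compose homeomorphic_imp_continuous_map by blast
  then have "{\<alpha> \<in> topspace Y. (f \<circ> L) \<alpha> \<in> f ` A} \<in> P Y"
    using P(1) Y Z' unfolding nice_pointclass_def by blast
  moreover have "f (L \<alpha>) \<in> f ` A \<longleftrightarrow> L \<alpha> \<in> A" if "\<alpha> \<in> topspace Y" for \<alpha>
  proof -
    have "L \<alpha> \<in> topspace Z"
      using L that by (auto simp: continuous_map_def)
    then show ?thesis
      using homeomorphic_imp_injective_map[OF Z'(2)] \<open>A \<subseteq> topspace Z\<close> by (simp add: inj_on_image_mem_iff)
  qed
  ultimately have "{\<alpha> \<in> topspace Y. L \<alpha> \<in> A} \<in> P Y"
    by (simp cong: conj_cong)
  then show ?thesis
    using P(2) Y by (simp add: pointclass_BP_def)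
qed

text \<open>This supplies the pointwise hypothesis of \<open>uniformly_small_loops\<close>; it is
  here that the pointclass and category enter.\<close>

lemma (in path_connected_space) locally_small_loops:
  assumes P: "nice_pointclass P" "pointclass_BP P" and X: "compact X"
    and G: "mono G" "\<And>n::nat. G n \<lhd> fundamental_group X x"
      "\<And>n. subgroup_of_pointclass P X x (G n)" "(\<Union>n. G n) = carrier (fundamental_group X x)"
    and y: "y \<in> X"
  shows "\<exists>n. \<exists>\<epsilon>>0. \<forall>l. path_between (X \<inter> ball y \<epsilon>) y y l \<longrightarrow> path_class X x l \<in> G n"
proof (rule ccontr)
  let ?\<pi> = "fundamental_group X x" and ?\<Phi> = "path_class X x"
  assume "\<not> ?thesis"
  \<comment> \<open>The radius is tied to the index of the group, so that the chosen loops shrink to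
    \<open>y\<close> while \<open>l n\<close> avoids \<open>G n\<close>.\<close>
  then have "\<exists>l. path_between (X \<inter> ball y (inverse (real (Suc n)))) y y l \<and> ?\<Phi> l \<notin> G n" for n
    by (meson inverse_positive_iff_positive of_nat_0_less_iff zero_less_Suc)
  then obtain l where l: "\<And>n. path_between (X \<inter> ball y (inverse (real (Suc n)))) y y (l n)"
    "\<And>n. ?\<Phi> (l n) \<notin> G n"
    by metis
  \<comment> \<open>Every value other than 1 selects the constant loop, so \<open>g \<alpha>\<close>
    is a shrinking family for arbitrary real sequences \<open>\<alpha>\<close> and not only for
    points of \<open>cantor_set\<close>.\<close>
  define g where "g \<alpha> n = (if \<alpha> n = (1::real) then l n else (\<lambda>_. y))" for \<alpha> n
  have small: "path_image (g \<alpha> n) \<subseteq> cball y (inverse (real (Suc k)))" if "k \<le> n" for \<alpha> k n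
  proof -
    have "inverse (real (Suc n)) \<le> inverse (real (Suc k))"
      using that by (simp add: le_imp_inverse_le)
    then have "ball y (inverse (real (Suc n))) \<subseteq> cball y (inverse (real (Suc k)))"
      by (rule order_trans[OF ball_subset_cball subset_cball])
    then show ?thesis
      using l(1)[of n] unfolding g_def path_between_def by (auto simp: path_image_def)
  qed
  have g: "shrinking_loops X y (g \<alpha>)" for \<alpha>
    unfolding shrinking_loops_def
  proof (intro conjI allI impI)
    show "path_between X y y (g \<alpha> n)" for n
      using path_between_mono[OF l(1)[of n]] path_between_const[OF y] by (simp add: g_def)
    fix \<epsilon> :: real assume "\<epsilon> > 0"
    then obtain k where k: "inverse (real (Suc k)) < \<epsilon>"
      using reals_Archimedean by blast
    have "path_image (g \<alpha> n) \<subseteq> cball y \<epsilon>" if "n \<ge> k" for n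
      using small[OF that, of \<alpha>] subset_cball[of "inverse (real (Suc k))" \<epsilon> y] k by auto
    then show "\<exists>k. \<forall>n\<ge>k. path_image (g \<alpha> n) \<subseteq> cball y \<epsilon>" by blast
  qed (rule y)
  define I where "I \<alpha> = infinite_concat y (g \<alpha>)" for \<alpha>
  have I: "path_between X y y (I \<alpha>)" for \<alpha>
    unfolding I_def by (rule path_between_infinite_concat[OF X g])
  \<comment> \<open>Both infinite concatenations are within \<open>inverse (real (Suc k))\<close> of
    the finite concatenation of the first \<open>k\<close> factors, which they share.\<close>
  have I_close: "dist (I \<alpha> t) (I \<beta> t) \<le> 2 * inverse (real (Suc k))"
    if "\<beta> \<in> cylinder \<alpha> k" "t \<in> {0..1}" for \<alpha> \<beta> k t
  proof -
    have "finite_concat y k (g \<alpha>) = finite_concat y k (g \<beta>)"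
      using that(1) by (intro finite_concat_cong) (simp add: g_def cylinder_def)
    moreover have "dist (finite_concat y k (g \<gamma>) t) (I \<gamma> t) \<le> inverse (real (Suc k))" for \<gamma>
      unfolding I_def using small that(2) by (intro dist_finite_infinite_concat[OF X g]) auto
    ultimately show ?thesis
      using dist_triangle3[of "I \<alpha> t" "I \<beta> t" "finite_concat y k (g \<alpha>) t"]
      by (smt (verit))
  qed
  define c where "c = connecting_path X x y"
  have c: "path_between X x y c"
    unfolding c_def by (rule connecting_path[OF y])
  \<comment> \<open>The loops \<open>I \<alpha>\<close> are based at \<open>y\<close>, while the
    pointclass hypothesis concerns extensional loops at \<open>x\<close>; hence the transport along
    \<open>c\<close> and the restriction to the unit interval.\<close>
  define J where "J \<alpha> = c +++ (I \<alpha> +++ reversepath c)" for \<alpha>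
  define L where "L \<alpha> = restrict (J \<alpha>) {0..1}" for \<alpha>
  have J: "path_between X x x (J \<alpha>)" for \<alpha>
    unfolding J_def by (rule path_between_join[OF c path_between_join[OF I path_between_reverse[OF c]]])
  have L: "L \<alpha> \<in> loops X x" for \<alpha>
    unfolding L_def using J[of \<alpha>] by (intro restrict_loop(1)) (auto simp: path_between_def)
  have mem_iff: "L \<alpha> \<in> \<Union>(G n) \<longleftrightarrow> ?\<Phi> (I \<alpha>) \<in> G n" for \<alpha> n
  proof -
    have "path_between X x x (L \<alpha>)"
      using L[of \<alpha>] by (simp add: loops_def path_between_def)
    moreover have "?\<Phi> (J \<alpha>) = ?\<Phi> (L \<alpha>)"
      by (rule path_class_cong_on[OF J]) (simp add: L_def)
    ultimately have "loop_class X x (L \<alpha>) = ?\<Phi> (J \<alpha>)"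
      using path_class_loop by simp
    moreover have "G n \<subseteq> carrier ?\<pi>"
      using G(4) by blast
    ultimately show ?thesis
      using mem_Union_classes_iff[OF _ L] path_class_conjugate[OF G(2) c I] by (simp add: J_def)
  qed
  have "continuous_map cantor_space (loop_topology X x) L"
  proof (rule continuous_map_into_loop_topology[OF L])
    fix \<epsilon> :: real assume "\<epsilon> > 0"
    then obtain k where k: "inverse (real (Suc k)) < \<epsilon> / 2"
      using reals_Archimedean[of "\<epsilon> / 2"] by auto
    have "dist (L \<alpha> t) (L \<beta> t) \<le> \<epsilon>" if \<beta>: "\<beta> \<in> cylinder \<alpha> k" and t: "t \<in> {0..1}" for \<alpha> \<beta> t
    proof -
      have *: "dist (I \<alpha> s) (I \<beta> s) \<le> \<epsilon>" if "s \<in> {0..1}" for s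
        using I_close[OF \<beta> that] k by simp
      \<comment> \<open>\<open>I \<alpha>\<close> and \<open>I \<beta>\<close> occupy the parameters
        between 1/2 and 3/4, where their argument is \<open>2 * (2 * t - 1)\<close>; elsewhere the
        two loops coincide.\<close>
      show ?thesis
        using t \<open>\<epsilon> > 0\<close> *[of "2 * (2 * t - 1)"] by (auto simp: L_def J_def joinpaths_def)
    qed
    then show "\<exists>k. \<forall>\<alpha>\<in>cantor_set. \<forall>\<beta>\<in>cylinder \<alpha> k. \<forall>t\<in>{0..1}. dist (L \<alpha> t) (L \<beta> t) \<le> \<epsilon>"
      by blast
  qed
  then have "Baire_property_in cantor_space {\<alpha> \<in> topspace cantor_space. L \<alpha> \<in> \<Union>(G n)}" for n
    using G(3) by (intro Baire_property_vimage[OF P _ Polish_cantor_space])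
      (auto simp: subgroup_of_pointclass_def)
  then have BP: "Baire_property_in cantor_space {\<alpha> \<in> cantor_set. ?\<Phi> (I \<alpha>) \<in> G n}" for n
    unfolding mem_iff by simp
  have "?\<Phi> (I \<alpha>) \<in> (\<Union>n. G n)" for \<alpha>
    unfolding G(4) by (rule path_class_closed[OF I])
  then have "(\<Union>n. {\<alpha> \<in> cantor_set. ?\<Phi> (I \<alpha>) \<in> G n}) = cantor_set"
    by blast
  from cantor_cover_flip[OF BP this] obtain n k where
    "\<And>m. m \<ge> k \<Longrightarrow> \<exists>\<alpha>\<in>{\<alpha> \<in> cantor_set. ?\<Phi> (I \<alpha>) \<in> G n}.
      flip m \<alpha> \<in> {\<alpha> \<in> cantor_set. ?\<Phi> (I \<alpha>) \<in> G n}"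
    by blast
  \<comment> \<open>The index must be at least \<open>k\<close> for the flip, and at least
    \<open>n\<close> so that \<open>G n\<close> is contained in the group which \<open>l\<close>
    avoids at that index.\<close>
  then obtain \<alpha> where \<alpha>: "\<alpha> \<in> cantor_set" "?\<Phi> (I \<alpha>) \<in> G n" "?\<Phi> (I (flip (max n k) \<alpha>)) \<in> G n"
    by (metis (no_types, lifting) max.cobounded2 mem_Collect_eq)
  define m where "m = max n k"
  \<comment> \<open>One of \<alpha> and its flip has the value 1 at \<open>m\<close>; it is taken as
    \<beta>, so that changing this value to 0 erases exactly the factor \<open>l m\<close>.\<close>
  have "\<exists>\<beta>. \<beta> m = 1 \<and> ?\<Phi> (I \<beta>) \<in> G n \<and> ?\<Phi> (I (\<beta>(m := 0))) \<in> G n"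
  proof (cases "\<alpha> m = 1")
    case True
    then have "flip m \<alpha> = \<alpha>(m := 0)" by (simp add: flip_def)
    then show ?thesis using \<alpha> True by (auto simp: m_def)
  next
    case False
    then have "\<alpha> m = 0" using \<alpha>(1) by (auto simp: cantor_set_def)
    then have "(flip m \<alpha>)(m := 0) = \<alpha>" "flip m \<alpha> m = 1" by (auto simp: flip_def)
    then show ?thesis using \<alpha> by (metis m_def)
  qed
  then obtain \<beta> where \<beta>: "\<beta> m = 1" "?\<Phi> (I \<beta>) \<in> G n" "?\<Phi> (I (\<beta>(m := 0))) \<in> G n"
    by blast
  interpret N: normal "G n" ?\<pi> by (rule G(2))
  have "g (\<beta>(m := 0)) = (g \<beta>)(m := \<lambda>_. y)" by (auto simp: g_def)
  then have "?\<Phi> (infinite_concat y (g \<beta>)) \<otimes>\<^bsub>?\<pi>\<^esub> inv\<^bsub>?\<pi>\<^esub> ?\<Phi> (infinite_concat y ((g \<beta>)(m := \<lambda>_. y))) \<in> G n"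
    using \<beta>(2,3) unfolding I_def by simp
  then have "?\<Phi> (g \<beta> m) \<in> G n"
    by (rule erased_factor_in_normal[OF X G(2) g])
  then have "?\<Phi> (l m) \<in> G n"
    using \<beta>(1) by (simp add: g_def)
  moreover have "G n \<subseteq> G m"
    using G(1) by (simp add: monoD m_def)
  ultimately show False
    using l(2) by blast
qed

theorem theorem2:
  fixes X :: "'a::metric_space set" and x :: 'a and P :: pointclass
  assumes "nice_pointclass P" and "pointclass_BP P"
    and "Peano_continuum X" and "x \<in> X"
  shows "\<not> (\<exists>G :: nat \<Rightarrow> (real \<Rightarrow> 'a) set set.
      strict_mono G \<and>
      (\<forall>n. normal (G n) (fundamental_group X x) \<and> subgroup_of_pointclass P X x (G n)) \<and>
      (\<Union>n. G n) = carrier (fundamental_group X x))"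
proof
  assume "\<exists>G :: nat \<Rightarrow> (real \<Rightarrow> 'a) set set.
      strict_mono G \<and>
      (\<forall>n. normal (G n) (fundamental_group X x) \<and> subgroup_of_pointclass P X x (G n)) \<and>
      (\<Union>n. G n) = carrier (fundamental_group X x)"
  then obtain G :: "nat \<Rightarrow> (real \<Rightarrow> 'a) set set" where strict: "strict_mono G"
    and G: "\<And>n. G n \<lhd> fundamental_group X x" "\<And>n. subgroup_of_pointclass P X x (G n)"
      "(\<Union>n. G n) = carrier (fundamental_group X x)"
    by blast
  have X: "compact X" "path_connected X" "locally path_connected X"
    using assms(3) by (auto simp: Peano_continuum_def)
  interpret path_connected_space X x
    using X(2) assms(4) by unfold_locales
  have mono: "mono G"
    using strict by (rule strict_mono_mono)
  obtain N \<epsilon> where N: "\<epsilon> > 0" "contains_small_loops X x \<epsilon> (G N)"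
  proof (rule uniformly_small_loops[OF X(1,3) mono G(1)])
    show "\<exists>n. \<exists>\<epsilon>>0. \<forall>l. path_between (X \<inter> ball y \<epsilon>) y y l \<longrightarrow> path_class X x l \<in> G n"
      if "y \<in> X" for y
      by (rule locally_small_loops[OF assms(1,2) X(1) mono G that])
  qed (rule that)
  obtain E where E: "finite E" "E \<subseteq> carrier (fundamental_group X x)"
    "\<And>H. H \<lhd> fundamental_group X x \<Longrightarrow> E \<subseteq> H \<Longrightarrow>
      contains_small_loops X x \<epsilon> H \<Longrightarrow> H = carrier (fundamental_group X x)"
    using finitely_generated_modulo_small_loops[OF X(1,3) N(1)] by blast
  \<comment> \<open>As \<open>E\<close> is finite and \<open>G\<close> increasing, the largest index
    needed for an element of \<open>E\<close> serves all of them.\<close>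
  have "\<exists>n. \<forall>A\<in>E. A \<in> G n"
  proof -
    have "\<exists>n. A \<in> G n" if "A \<in> E" for A
      using that E(2) G(3) by blast
    then obtain n where n: "\<And>A. A \<in> E \<Longrightarrow> A \<in> G (n A)"
      by metis
    have "A \<in> G (Max (n ` E))" if "A \<in> E" for A
      using n[OF that] monoD[OF mono, of "n A" "Max (n ` E)"] E(1) that by auto
    then show ?thesis by blast
  qed
  then obtain n where n: "E \<subseteq> G n" by blast
  \<comment> \<open>From this index on the group contains both \<open>E\<close> and all
    \<open>\<epsilon>\<close>-small loops, so it is the whole group and leaves no room for a
    strictly larger \<open>G (Suc M)\<close>.\<close>
  define M where "M = max n N"
  have "G n \<subseteq> G M" "G N \<subseteq> G M"
    using mono by (simp_all add: monoD M_def)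
  then have "G M = carrier (fundamental_group X x)"
    using n N(2) by (intro E(3)[OF G(1)]) (auto simp: contains_small_loops_def)
  moreover have "G M \<subset> G (Suc M)"
    using strict by (simp add: strict_mono_def)
  ultimately show False
    using G(3) by blast
qed

end
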